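(* Let $R$ be a (possibly noncommutative) ring with identity satisfying the ascending chain condition on right annihilators. Then $R$ is right FI-extending (that is, the right $R$-module $R_R$ is FI-extending) if and only if every finitely generated projective right $R$-module is FI-extending.
   Context: All modules are unital right $R$-modules. A submodule $N$ of a right $R$-module $M$ is fully invariant if $f(N)\subseteq N$ for every $f\in \mathrm{End}_R(M)$. A submodule $N$ of a module $X$ is essential in $X$ if $N\cap Y\neq 0$ for every nonzero submodule $Y$ of $X$. A right $R$-module $M$ is called FI-extending if every fully invariant submodule of $M$ is essential in a direct summand of $M$ (i.e. for each fully invariant submodule $N$ of $M$ there is a direct summand $D$ of $M$ with $N\subseteq D$ and $N$ essential in $D$). A right annihilator in $R$ is a right ideal of the form $\{r\in R : xr=0 \text{ for all } x\in X\}$ for some subset $X\subseteq R$; $R$ has ACC on right annihilators if every ascending chain of right annihilators stabilizes. *)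

theory Defs
  imports "HOL-Algebra.AbelCoset"
begin

section \<open>Right modules over a possibly noncommutative ring\<close>

text \<open>HOL-Algebra only has left modules over commutative rings. As for its record
  \<^verbatim>\<open>module\<close>, the multiplicative fields inherited from \<^verbatim>\<open>ring\<close> carry no information.\<close>

record ('a, 'b) rmodule = "'b ring" +
  rsmult :: "['b, 'a] \<Rightarrow> 'b" (infixl \<open>\<star>\<index>\<close> 70)

locale right_module = R?: ring R + M?: abelian_group M
  for R :: "('a, 'r) ring_scheme" (structure) and M :: "('a, 'm) rmodule" (structure) +
  assumes rsmult_closed [simp, intro]:
      "\<lbrakk>x \<in> carrier M; a \<in> carrier R\<rbrakk> \<Longrightarrow> x \<star>\<^bsub>M\<^esub> a \<in> carrier M"
    and rsmult_add_left:
      "\<lbrakk>x \<in> carrier M; y \<in> carrier M; a \<in> carrier R\<rbrakk>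
        \<Longrightarrow> (x \<oplus>\<^bsub>M\<^esub> y) \<star>\<^bsub>M\<^esub> a = x \<star>\<^bsub>M\<^esub> a \<oplus>\<^bsub>M\<^esub> y \<star>\<^bsub>M\<^esub> a"
    and rsmult_add_right:
      "\<lbrakk>x \<in> carrier M; a \<in> carrier R; b \<in> carrier R\<rbrakk>
        \<Longrightarrow> x \<star>\<^bsub>M\<^esub> (a \<oplus>\<^bsub>R\<^esub> b) = x \<star>\<^bsub>M\<^esub> a \<oplus>\<^bsub>M\<^esub> x \<star>\<^bsub>M\<^esub> b"
    and rsmult_assoc:
      "\<lbrakk>x \<in> carrier M; a \<in> carrier R; b \<in> carrier R\<rbrakk>
        \<Longrightarrow> x \<star>\<^bsub>M\<^esub> (a \<otimes>\<^bsub>R\<^esub> b) = (x \<star>\<^bsub>M\<^esub> a) \<star>\<^bsub>M\<^esub> b"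
    and rsmult_one [simp]:
      "x \<in> carrier M \<Longrightarrow> x \<star>\<^bsub>M\<^esub> \<one>\<^bsub>R\<^esub> = x"

definition regular_rmodule :: "('a, 'r) ring_scheme \<Rightarrow> ('a, 'a) rmodule" where
  "regular_rmodule R = \<lparr>carrier = carrier R, mult = mult R, one = one R,
     zero = zero R, add = add R, rsmult = mult R\<rparr>"

definition rsubmodule ::
    "('a, 'r) ring_scheme \<Rightarrow> ('a, 'm) rmodule \<Rightarrow> 'm set \<Rightarrow> bool" where
  "rsubmodule R M N \<longleftrightarrow> additive_subgroup N M \<and>
     (\<forall>x\<in>N. \<forall>a\<in>carrier R. x \<star>\<^bsub>M\<^esub> a \<in> N)"

definition rmodule_hom ::
    "('a, 'r) ring_scheme \<Rightarrow> ('a, 'm) rmodule \<Rightarrow> ('a, 'n) rmodule \<Rightarrow> ('m \<Rightarrow> 'n) set" where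
  "rmodule_hom R M N = {f \<in> carrier M \<rightarrow> carrier N.
     (\<forall>x\<in>carrier M. \<forall>y\<in>carrier M. f (x \<oplus>\<^bsub>M\<^esub> y) = f x \<oplus>\<^bsub>N\<^esub> f y) \<and>
     (\<forall>x\<in>carrier M. \<forall>a\<in>carrier R. f (x \<star>\<^bsub>M\<^esub> a) = f x \<star>\<^bsub>N\<^esub> a)}"


section \<open>FI-extending modules\<close>

definition fully_invariant ::
    "('a, 'r) ring_scheme \<Rightarrow> ('a, 'm) rmodule \<Rightarrow> 'm set \<Rightarrow> bool" where
  "fully_invariant R M N \<longleftrightarrow> rsubmodule R M N \<and> (\<forall>f\<in>rmodule_hom R M M. f ` N \<subseteq> N)"

text \<open>Both \<open>N\<close> and \<open>X\<close> are submodules of an ambient module \<open>M\<close>; the submodules of the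
  module \<open>X\<close> are the submodules of \<open>M\<close> contained in \<open>X\<close>.\<close>

definition essential_in ::
    "('a, 'r) ring_scheme \<Rightarrow> ('a, 'm) rmodule \<Rightarrow> 'm set \<Rightarrow> 'm set \<Rightarrow> bool" where
  "essential_in R M N X \<longleftrightarrow> rsubmodule R M N \<and> rsubmodule R M X \<and> N \<subseteq> X \<and>
     (\<forall>Y. rsubmodule R M Y \<and> Y \<subseteq> X \<and> Y \<noteq> {\<zero>\<^bsub>M\<^esub>} \<longrightarrow> N \<inter> Y \<noteq> {\<zero>\<^bsub>M\<^esub>})"

definition direct_summand ::
    "('a, 'r) ring_scheme \<Rightarrow> ('a, 'm) rmodule \<Rightarrow> 'm set \<Rightarrow> bool" where
  "direct_summand R M D \<longleftrightarrow> rsubmodule R M D \<and>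
     (\<exists>E. rsubmodule R M E \<and> D \<inter> E = {\<zero>\<^bsub>M\<^esub>} \<and> D <+>\<^bsub>M\<^esub> E = carrier M)"

definition FI_extending :: "('a, 'r) ring_scheme \<Rightarrow> ('a, 'm) rmodule \<Rightarrow> bool" where
  "FI_extending R M \<longleftrightarrow>
     (\<forall>N. fully_invariant R M N \<longrightarrow> (\<exists>D. direct_summand R M D \<and> essential_in R M N D))"

definition right_FI_extending :: "('a, 'r) ring_scheme \<Rightarrow> bool" where
  "right_FI_extending R \<longleftrightarrow> FI_extending R (regular_rmodule R)"


section \<open>Chain condition on right annihilators\<close>

definition right_annihilator :: "('a, 'r) ring_scheme \<Rightarrow> 'a set \<Rightarrow> 'a set" where
  "right_annihilator R X = {a \<in> carrier R. \<forall>x\<in>X. x \<otimes>\<^bsub>R\<^esub> a = \<zero>\<^bsub>R\<^esub>}"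

definition acc_right_annihilators :: "('a, 'r) ring_scheme \<Rightarrow> bool" where
  "acc_right_annihilators R \<longleftrightarrow>
     (\<forall>A :: nat \<Rightarrow> 'a set.
        (\<forall>n. \<exists>X\<subseteq>carrier R. A n = right_annihilator R X) \<and> (\<forall>n. A n \<subseteq> A (Suc n))
        \<longrightarrow> (\<exists>n. \<forall>m\<ge>n. A m = A n))"


section \<open>Finitely generated and projective modules\<close>

definition rmodule_span ::
    "('a, 'r) ring_scheme \<Rightarrow> ('a, 'm) rmodule \<Rightarrow> 'm set \<Rightarrow> 'm set" where
  "rmodule_span R M S = \<Inter>{N. rsubmodule R M N \<and> S \<subseteq> N}"

definition finitely_generated_rmodule ::
    "('a, 'r) ring_scheme \<Rightarrow> ('a, 'm) rmodule \<Rightarrow> bool" where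
  "finitely_generated_rmodule R M \<longleftrightarrow>
     (\<exists>S\<subseteq>carrier M. finite S \<and> rmodule_span R M S = carrier M)"

text \<open>The usual lifting property along epimorphisms. A definition cannot quantify over
  types, so the test modules live on the fixed types \<^typ>\<open>'m \<Rightarrow> 'a\<close> and \<^typ>\<open>'m\<close>. These
  are large enough to accommodate the canonical epimorphism onto \<open>P\<close> from the free module
  on its elements. So no generality is lost: the lemma \<open>projective_rmodule_lift\<close> below
  gives the lifting property for test modules on arbitrary types.\<close>

definition projective_rmodule :: "('a, 'r) ring_scheme \<Rightarrow> ('a, 'm) rmodule \<Rightarrow> bool" where
  "projective_rmodule R P \<longleftrightarrow>
     (\<forall>(A :: ('a, 'm \<Rightarrow> 'a) rmodule) (B :: ('a, 'm) rmodule) g f.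
        right_module R A \<and> right_module R B \<and>
        g \<in> rmodule_hom R A B \<and> g ` carrier A = carrier B \<and> f \<in> rmodule_hom R P B
        \<longrightarrow> (\<exists>h\<in>rmodule_hom R P A. \<forall>x\<in>carrier P. g (h x) = f x))"


text \<open>For the same reason, ``every finitely generated projective right module'' is to be
  rendered as: every such module on an arbitrary carrier type \<^typ>\<open>'m\<close>, and every such
  module on the type \<^typ>\<open>'a\<close> of the ring elements. Without the second clause an instance
  such as \<^typ>\<open>unit\<close> for \<^typ>\<open>'m\<close> would only see zero modules.\<close>


section \<open>Basic facts\<close>

lemma (in ring) right_module_regular: "right_module R (regular_rmodule R)"
proof -
  have "abelian_group (regular_rmodule R)"
    by (rule abelian_groupI)
      (auto simp: regular_rmodule_def a_assoc a_comm a_lcomm intro: bexI[of _ "\<ominus> _"] l_neg)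
  then show ?thesis
    by (intro right_module.intro right_module_axioms.intro)
      (auto simp: regular_rmodule_def l_distr r_distr m_assoc intro: ring_axioms)
qed

subsection \<open>The free module on a set\<close>

definition free_rmodule :: "('a, 'r) ring_scheme \<Rightarrow> 'm set \<Rightarrow> ('a, 'm \<Rightarrow> 'a) rmodule" where
  "free_rmodule R X = \<lparr>
     carrier = {\<phi>. range \<phi> \<subseteq> carrier R \<and> {x. \<phi> x \<noteq> \<zero>\<^bsub>R\<^esub>} \<subseteq> X \<and> finite {x. \<phi> x \<noteq> \<zero>\<^bsub>R\<^esub>}},
     mult = undefined, one = undefined,
     zero = (\<lambda>_. \<zero>\<^bsub>R\<^esub>), add = (\<lambda>\<phi> \<psi> x. \<phi> x \<oplus>\<^bsub>R\<^esub> \<psi> x),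
     rsmult = (\<lambda>\<phi> a x. \<phi> x \<otimes>\<^bsub>R\<^esub> a)\<rparr>"

lemma (in ring) free_rmodule_mem:
  assumes "\<And>x. \<phi> x \<in> carrier R" "\<And>x. x \<notin> S \<Longrightarrow> \<phi> x = \<zero>" "finite S" "S \<subseteq> X"
  shows "\<phi> \<in> carrier (free_rmodule R X)"
proof -
  have "{x. \<phi> x \<noteq> \<zero>} \<subseteq> S" using assms(2) by blast
  then show ?thesis
    using assms finite_subset[of "{x. \<phi> x \<noteq> \<zero>}" S] by (auto simp: free_rmodule_def)
qed

lemma (in ring) right_module_free: "right_module R (free_rmodule R X)"
proof -
  let ?F = "free_rmodule R X"
  let ?s = "\<lambda>\<phi>. {x. \<phi> x \<noteq> \<zero>}"
  have val: "\<phi> x \<in> carrier R" if "\<phi> \<in> carrier ?F" for \<phi> x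
    using that by (auto simp: free_rmodule_def)
  have sup: "finite (?s \<phi>)" "?s \<phi> \<subseteq> X" if "\<phi> \<in> carrier ?F" for \<phi>
    using that by (auto simp: free_rmodule_def)
  have add: "(\<lambda>x. \<phi> x \<oplus> \<psi> x) \<in> carrier ?F" if "\<phi> \<in> carrier ?F" "\<psi> \<in> carrier ?F" for \<phi> \<psi>
    by (rule free_rmodule_mem[where S = "?s \<phi> \<union> ?s \<psi>"]) (use that sup val in auto)
  have scal: "(\<lambda>x. \<phi> x \<otimes> a) \<in> carrier ?F" if "\<phi> \<in> carrier ?F" "a \<in> carrier R" for \<phi> a
    by (rule free_rmodule_mem[where S = "?s \<phi>"]) (use that sup val in auto)
  have neg: "(\<lambda>x. \<ominus> \<phi> x) \<in> carrier ?F" if "\<phi> \<in> carrier ?F" for \<phi>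
    by (rule free_rmodule_mem[where S = "?s \<phi>"]) (use that sup val in auto)
  have zero: "(\<lambda>_. \<zero>) \<in> carrier ?F"
    by (rule free_rmodule_mem[where S = "{}"]) auto
  have ops: "add ?F = (\<lambda>\<phi> \<psi> x. \<phi> x \<oplus> \<psi> x)" "\<zero>\<^bsub>?F\<^esub> = (\<lambda>_. \<zero>)"
    "rsmult ?F = (\<lambda>\<phi> a x. \<phi> x \<otimes> a)"
    by (simp_all add: free_rmodule_def)
  have "abelian_group ?F"
  proof (rule abelian_groupI)
    fix \<phi> assume "\<phi> \<in> carrier ?F"
    then show "\<exists>\<psi>\<in>carrier ?F. \<psi> \<oplus>\<^bsub>?F\<^esub> \<phi> = \<zero>\<^bsub>?F\<^esub>"
      by (intro bexI[OF _ neg]) (auto simp: ops val l_neg)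
  qed (auto simp: ops val add zero a_assoc a_comm a_lcomm)
  then show ?thesis
    by (intro right_module.intro right_module_axioms.intro)
      (auto simp: ops val scal l_distr r_distr m_assoc intro: ring_axioms)
qed

lemma rmodule_homD:
  assumes "f \<in> rmodule_hom R M N"
  shows "x \<in> carrier M \<Longrightarrow> f x \<in> carrier N"
    and "\<lbrakk>x \<in> carrier M; y \<in> carrier M\<rbrakk> \<Longrightarrow> f (x \<oplus>\<^bsub>M\<^esub> y) = f x \<oplus>\<^bsub>N\<^esub> f y"
    and "\<lbrakk>x \<in> carrier M; a \<in> carrier R\<rbrakk> \<Longrightarrow> f (x \<star>\<^bsub>M\<^esub> a) = f x \<star>\<^bsub>N\<^esub> a"
  using assms by (auto simp: rmodule_hom_def)

lemma (in right_module) rsmult_zero_right: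
  "x \<in> carrier M \<Longrightarrow> x \<star>\<^bsub>M\<^esub> \<zero>\<^bsub>R\<^esub> = \<zero>\<^bsub>M\<^esub>"
  by (metis R.add.l_cancel_one' R.zero_closed M.add.l_cancel_one' R.l_zero
      rsmult_add_right rsmult_closed)

lemma (in right_module) rsmult_zero_left:
  "a \<in> carrier R \<Longrightarrow> \<zero>\<^bsub>M\<^esub> \<star>\<^bsub>M\<^esub> a = \<zero>\<^bsub>M\<^esub>"
  by (metis M.add.l_cancel_one' M.zero_closed M.l_zero rsmult_add_left rsmult_closed)

lemma (in right_module) finsum_rsmult:
  assumes "finite S" "u \<in> S \<rightarrow> carrier M" "a \<in> carrier R"
  shows "finsum M (\<lambda>x. u x \<star>\<^bsub>M\<^esub> a) S = finsum M u S \<star>\<^bsub>M\<^esub> a"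
  using assms
proof (induction S rule: finite_induct)
  case empty
  then show ?case by (simp add: rsmult_zero_left)
next
  case (insert x S)
  then show ?case by (simp add: M.finsum_insert rsmult_add_left Pi_iff)
qed

lemma rmodule_hom_zero:
  assumes "right_module R M" "right_module R N" "f \<in> rmodule_hom R M N"
  shows "f \<zero>\<^bsub>M\<^esub> = \<zero>\<^bsub>N\<^esub>"
proof -
  interpret M: right_module R M by fact
  interpret N: right_module R N by fact
  have "f \<zero>\<^bsub>M\<^esub> \<oplus>\<^bsub>N\<^esub> f \<zero>\<^bsub>M\<^esub> = f \<zero>\<^bsub>M\<^esub>"
    using rmodule_homD(2)[OF assms(3), of "\<zero>\<^bsub>M\<^esub>" "\<zero>\<^bsub>M\<^esub>"] by simp
  then show ?thesis
    using rmodule_homD(1)[OF assms(3), of "\<zero>\<^bsub>M\<^esub>"] by simp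
qed

lemma rmodule_hom_finsum:
  assumes "right_module R M" "right_module R N" "f \<in> rmodule_hom R M N"
    and "finite S" "u \<in> S \<rightarrow> carrier M"
  shows "f (finsum M u S) = finsum N (\<lambda>x. f (u x)) S"
proof -
  interpret M: right_module R M by fact
  interpret N: right_module R N by fact
  show ?thesis
    using assms(4,5)
  proof (induction S rule: finite_induct)
    case empty
    then show ?case by (simp add: rmodule_hom_zero[OF assms(1-3)])
  next
    case (insert x S)
    then have "(\<lambda>x. f (u x)) \<in> S \<rightarrow> carrier N" "f (u x) \<in> carrier N"
      using rmodule_homD(1)[OF assms(3)] by auto
    with insert show ?case
      by (simp add: M.M.finsum_insert N.M.finsum_insert rmodule_homD(2)[OF assms(3)] Pi_iff)
  qed
qed

definition free_eval ::
    "('a, 'r) ring_scheme \<Rightarrow> ('a, 'n) rmodule \<Rightarrow> ('m \<Rightarrow> 'n) \<Rightarrow> ('m \<Rightarrow> 'a) \<Rightarrow> 'n" where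
  "free_eval R A u \<phi> = finsum A (\<lambda>x. u x \<star>\<^bsub>A\<^esub> \<phi> x) {x. \<phi> x \<noteq> \<zero>\<^bsub>R\<^esub>}"

lemma free_eval_superset:
  assumes "right_module R A" "u \<in> X \<rightarrow> carrier A" "\<phi> \<in> carrier (free_rmodule R X)"
    and "finite S" "{x. \<phi> x \<noteq> \<zero>\<^bsub>R\<^esub>} \<subseteq> S" "S \<subseteq> X"
  shows "free_eval R A u \<phi> = finsum A (\<lambda>x. u x \<star>\<^bsub>A\<^esub> \<phi> x) S"
proof -
  interpret A: right_module R A by fact
  have "\<phi> x \<in> carrier R" for x using assms(3) by (auto simp: free_rmodule_def)
  then show ?thesis
    unfolding free_eval_def using assms(2,4-6)
    by (intro A.M.add.finprod_mono_neutral_cong_left)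
      (auto simp: A.rsmult_zero_right Pi_iff subset_iff)
qed

lemma free_eval_hom:
  assumes "right_module R A" "u \<in> X \<rightarrow> carrier A"
  shows "free_eval R A u \<in> rmodule_hom R (free_rmodule R X) A"
proof -
  interpret A: right_module R A by fact
  let ?F = "free_rmodule R X"
  interpret F: right_module R ?F by (rule A.R.right_module_free)
  let ?s = "\<lambda>\<phi>. {x. \<phi> x \<noteq> \<zero>\<^bsub>R\<^esub>}"
  have val: "\<phi> x \<in> carrier R" if "\<phi> \<in> carrier ?F" for \<phi> x
    using that by (auto simp: free_rmodule_def)
  have sup: "finite (?s \<phi>)" "?s \<phi> \<subseteq> X" if "\<phi> \<in> carrier ?F" for \<phi>
    using that by (auto simp: free_rmodule_def)
  have ops: "add ?F = (\<lambda>\<phi> \<psi> x. \<phi> x \<oplus>\<^bsub>R\<^esub> \<psi> x)" "rsmult ?F = (\<lambda>\<phi> a x. \<phi> x \<otimes>\<^bsub>R\<^esub> a)"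
    by (simp_all add: free_rmodule_def)
  have trm: "u x \<star>\<^bsub>A\<^esub> \<phi> x \<in> carrier A" if "\<phi> \<in> carrier ?F" "x \<in> X" for \<phi> x
    using assms(2) that val by auto
  have closed: "free_eval R A u \<phi> \<in> carrier A" if "\<phi> \<in> carrier ?F" for \<phi>
    unfolding free_eval_def using sup[OF that] trm[OF that]
    by (intro A.M.finsum_closed) auto
  have add: "free_eval R A u (\<phi> \<oplus>\<^bsub>?F\<^esub> \<psi>) = free_eval R A u \<phi> \<oplus>\<^bsub>A\<^esub> free_eval R A u \<psi>"
    if p: "\<phi> \<in> carrier ?F" and q: "\<psi> \<in> carrier ?F" for \<phi> \<psi>
  proof -
    let ?S = "?s \<phi> \<union> ?s \<psi>"
    have S: "finite ?S" "?S \<subseteq> X" using sup p q by auto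
    have "?s (\<phi> \<oplus>\<^bsub>?F\<^esub> \<psi>) \<subseteq> ?S" by (auto simp: ops)
    then have "free_eval R A u (\<phi> \<oplus>\<^bsub>?F\<^esub> \<psi>) = finsum A (\<lambda>x. u x \<star>\<^bsub>A\<^esub> (\<phi> \<oplus>\<^bsub>?F\<^esub> \<psi>) x) ?S"
      using p q S by (intro free_eval_superset[OF assms]) auto
    also have "\<dots> = finsum A (\<lambda>x. u x \<star>\<^bsub>A\<^esub> \<phi> x \<oplus>\<^bsub>A\<^esub> u x \<star>\<^bsub>A\<^esub> \<psi> x) ?S"
    proof (rule A.M.finsum_cong')
      fix x assume "x \<in> ?S"
      then have "x \<in> X" using S by blast
      then show "u x \<star>\<^bsub>A\<^esub> (\<phi> \<oplus>\<^bsub>?F\<^esub> \<psi>) x = u x \<star>\<^bsub>A\<^esub> \<phi> x \<oplus>\<^bsub>A\<^esub> u x \<star>\<^bsub>A\<^esub> \<psi> x"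
        using assms(2) p q val by (auto simp: ops intro!: A.rsmult_add_right)
    next
      show "(\<lambda>x. u x \<star>\<^bsub>A\<^esub> \<phi> x \<oplus>\<^bsub>A\<^esub> u x \<star>\<^bsub>A\<^esub> \<psi> x) \<in> ?S \<rightarrow> carrier A"
        using trm p q S by blast
    qed simp
    also have "\<dots> = finsum A (\<lambda>x. u x \<star>\<^bsub>A\<^esub> \<phi> x) ?S \<oplus>\<^bsub>A\<^esub> finsum A (\<lambda>x. u x \<star>\<^bsub>A\<^esub> \<psi> x) ?S"
      using trm p q S by (intro A.M.finsum_addf) blast+
    finally show ?thesis
      using free_eval_superset[OF assms p S(1) _ S(2)] free_eval_superset[OF assms q S(1) _ S(2)]
      by auto
  qed
  have smult: "free_eval R A u (\<phi> \<star>\<^bsub>?F\<^esub> a) = free_eval R A u \<phi> \<star>\<^bsub>A\<^esub> a"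
    if p: "\<phi> \<in> carrier ?F" and a: "a \<in> carrier R" for \<phi> a
  proof -
    have S: "finite (?s \<phi>)" "?s \<phi> \<subseteq> X" using sup p by auto
    have "?s (\<phi> \<star>\<^bsub>?F\<^esub> a) \<subseteq> ?s \<phi>" using a by (auto simp: ops)
    then have "free_eval R A u (\<phi> \<star>\<^bsub>?F\<^esub> a) = finsum A (\<lambda>x. u x \<star>\<^bsub>A\<^esub> (\<phi> \<star>\<^bsub>?F\<^esub> a) x) (?s \<phi>)"
      using p a S by (intro free_eval_superset[OF assms]) auto
    also have "\<dots> = finsum A (\<lambda>x. (u x \<star>\<^bsub>A\<^esub> \<phi> x) \<star>\<^bsub>A\<^esub> a) (?s \<phi>)"
    proof (rule A.M.finsum_cong')
      fix x assume "x \<in> ?s \<phi>"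
      then have "x \<in> X" using S by blast
      then show "u x \<star>\<^bsub>A\<^esub> (\<phi> \<star>\<^bsub>?F\<^esub> a) x = (u x \<star>\<^bsub>A\<^esub> \<phi> x) \<star>\<^bsub>A\<^esub> a"
        using assms(2) p a val by (auto simp: ops intro!: A.rsmult_assoc)
    next
      show "(\<lambda>x. (u x \<star>\<^bsub>A\<^esub> \<phi> x) \<star>\<^bsub>A\<^esub> a) \<in> ?s \<phi> \<rightarrow> carrier A"
        using trm p a S by blast
    qed simp
    also have "\<dots> = finsum A (\<lambda>x. u x \<star>\<^bsub>A\<^esub> \<phi> x) (?s \<phi>) \<star>\<^bsub>A\<^esub> a"
      using A.finsum_rsmult[OF S(1) _ a, of "\<lambda>x. u x \<star>\<^bsub>A\<^esub> \<phi> x"] trm p S by auto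
    finally show ?thesis by (simp add: free_eval_def)
  qed
  show ?thesis
    using closed add smult by (auto simp: rmodule_hom_def)
qed

subsection \<open>Lifting along epimorphisms between modules on arbitrary types\<close>

lemma projective_rmodule_lift:
  fixes P :: "('a, 'm) rmodule" and A :: "('a, 'n) rmodule" and B :: "('a, 'k) rmodule"
  assumes P: "right_module R P" "projective_rmodule R P"
    and A: "right_module R A" and B: "right_module R B"
    and g: "g \<in> rmodule_hom R A B" "g ` carrier A = carrier B" and f: "f \<in> rmodule_hom R P B"
  shows "\<exists>h\<in>rmodule_hom R P A. \<forall>x\<in>carrier P. g (h x) = f x"
proof -
  interpret P: right_module R P by fact
  interpret A: right_module R A by fact
  interpret B: right_module R B by fact
  let ?F = "free_rmodule R (carrier P)"
  let ?e = "free_eval R P (\<lambda>x. x)"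
  have F: "right_module R ?F" by (rule P.R.right_module_free)
  have e: "?e \<in> rmodule_hom R ?F P"
    by (rule free_eval_hom[OF P(1)]) auto
  have "p \<in> ?e ` carrier ?F" if p: "p \<in> carrier P" for p
  proof -
    let ?d = "\<lambda>x. if x = p then \<one>\<^bsub>R\<^esub> else \<zero>\<^bsub>R\<^esub>"
    have d: "?d \<in> carrier ?F"
      by (rule P.R.free_rmodule_mem[where S = "{p}"]) (use p in auto)
    have "?e ?d = finsum P (\<lambda>x. x \<star>\<^bsub>P\<^esub> ?d x) {p}"
      by (rule free_eval_superset[OF P(1) _ d]) (use p in auto)
    also have "\<dots> = p \<star>\<^bsub>P\<^esub> ?d p \<oplus>\<^bsub>P\<^esub> \<zero>\<^bsub>P\<^esub>"
      using p by (subst P.M.finsum_insert) auto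
    finally have "?e ?d = p" using p by simp
    with d show ?thesis by (metis image_eqI)
  qed
  then have surj: "?e ` carrier ?F = carrier P"
    using rmodule_homD(1)[OF e] by auto
  have "(\<lambda>x. x) \<in> rmodule_hom R P P"
    by (auto simp: rmodule_hom_def)
  with P F e surj obtain s where s: "s \<in> rmodule_hom R P ?F" "\<forall>x\<in>carrier P. ?e (s x) = x"
    unfolding projective_rmodule_def by meson
  have "\<forall>p\<in>carrier P. \<exists>y\<in>carrier A. g y = f p"
    using g(2) rmodule_homD(1)[OF f] by (metis imageE)
  then obtain u where u: "\<And>p. p \<in> carrier P \<Longrightarrow> u p \<in> carrier A \<and> g (u p) = f p"
    by metis
  then have uA: "u \<in> carrier P \<rightarrow> carrier A" by auto
  let ?v = "free_eval R A u"
  have v: "?v \<in> rmodule_hom R ?F A" by (rule free_eval_hom[OF A uA])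
  have gv: "g (?v \<phi>) = f (?e \<phi>)" if p: "\<phi> \<in> carrier ?F" for \<phi>
  proof -
    let ?S = "{x. \<phi> x \<noteq> \<zero>\<^bsub>R\<^esub>}"
    have S: "finite ?S" "?S \<subseteq> carrier P" and val: "\<And>x. \<phi> x \<in> carrier R"
      using p by (auto simp: free_rmodule_def)
    have "g (?v \<phi>) = finsum B (\<lambda>x. g (u x \<star>\<^bsub>A\<^esub> \<phi> x)) ?S"
      unfolding free_eval_def using S val u
      by (intro rmodule_hom_finsum[OF A B g(1)]) auto
    also have "\<dots> = finsum B (\<lambda>x. f (x \<star>\<^bsub>P\<^esub> \<phi> x)) ?S"
    proof (rule B.M.finsum_cong')
      fix x assume "x \<in> ?S"
      then have "x \<in> carrier P" using S by blast
      then show "g (u x \<star>\<^bsub>A\<^esub> \<phi> x) = f (x \<star>\<^bsub>P\<^esub> \<phi> x)"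
        using u val by (simp add: rmodule_homD(3)[OF g(1)] rmodule_homD(3)[OF f])
    next
      show "(\<lambda>x. f (x \<star>\<^bsub>P\<^esub> \<phi> x)) \<in> ?S \<rightarrow> carrier B"
        using S val by (auto intro!: rmodule_homD(1)[OF f])
    qed simp
    also have "\<dots> = f (?e \<phi>)"
      unfolding free_eval_def using S val
      by (intro rmodule_hom_finsum[OF P(1) B f, symmetric]) auto
    finally show ?thesis .
  qed
  have "(\<lambda>x. ?v (s x)) \<in> rmodule_hom R P A"
    using rmodule_homD[OF s(1)] rmodule_homD[OF v] by (auto simp: rmodule_hom_def)
  moreover have "\<forall>x\<in>carrier P. g (?v (s x)) = f x"
    using s(2) rmodule_homD(1)[OF s(1)] gv by simp
  ultimately show ?thesis by (intro bexI[where x = "\<lambda>x. ?v (s x)"])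
qed

end

theory Submission
  imports Defs
begin

text \<open>Let \<open>N\<close> be a fully invariant submodule of the finitely generated projective module \<open>P\<close>, with
  dual basis \<open>(u\<^sub>i, \<phi>\<^sub>i)\<close>. The ideal \<open>I = {c. P c \<subseteq> N}\<close> satisfies \<open>N = P I\<close> and is essential in some
  \<open>h R\<close> with \<open>h\<close> idempotent; put \<open>e = 1 - h\<close>. The endomorphisms \<open>a = \<Sum> u\<^sub>i e \<phi>\<^sub>i\<close> and
  \<open>b = \<Sum> u\<^sub>i h \<phi>\<^sub>i\<close> of \<open>P\<close> add up to the identity, and \<open>a b\<close> has its coefficients \<open>e \<phi>\<^sub>i(u\<^sub>j) h\<close> in
  the right singular ideal. By the Mewborn--Winton argument the chain condition makes this ideal
  nilpotent, hence \<open>a b\<close> is nilpotent and \<open>P\<close> is the direct sum of the parts on which \<open>a\<close>,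
  respectively \<open>b\<close>, acts nilpotently. The first of these contains \<open>N\<close> essentially, since modulo
  the singular ideal it consists of the elements all of whose coordinates lie in \<open>h R\<close>.\<close>

section \<open>Submodules and homomorphisms\<close>

lemma regular_rmodule_simps [simp]:
  "carrier (regular_rmodule R) = carrier R"
  "add (regular_rmodule R) = add R"
  "zero (regular_rmodule R) = zero R"
  "rsmult (regular_rmodule R) = mult R"
  by (simp_all add: regular_rmodule_def)

lemma rsubmoduleD:
  assumes "rsubmodule R M N"
  shows "N \<subseteq> carrier M" "\<zero>\<^bsub>M\<^esub> \<in> N"
    "\<And>x y. \<lbrakk>x \<in> N; y \<in> N\<rbrakk> \<Longrightarrow> x \<oplus>\<^bsub>M\<^esub> y \<in> N"
    "\<And>x a. \<lbrakk>x \<in> N; a \<in> carrier R\<rbrakk> \<Longrightarrow> x \<star>\<^bsub>M\<^esub> a \<in> N"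
  using assms unfolding rsubmodule_def
  by (auto simp: additive_subgroup.a_subset additive_subgroup.zero_closed
      additive_subgroup.a_closed dest: additive_subgroup.a_subset)

context right_module
begin

lemma rsmult_minus_one:
  assumes "x \<in> carrier M"
  shows "x \<star>\<^bsub>M\<^esub> (\<ominus>\<^bsub>R\<^esub> \<one>\<^bsub>R\<^esub>) = \<ominus>\<^bsub>M\<^esub> x"
proof -
  have "x \<star>\<^bsub>M\<^esub> (\<ominus>\<^bsub>R\<^esub> \<one>\<^bsub>R\<^esub>) \<oplus>\<^bsub>M\<^esub> x = x \<star>\<^bsub>M\<^esub> (\<ominus>\<^bsub>R\<^esub> \<one>\<^bsub>R\<^esub> \<oplus>\<^bsub>R\<^esub> \<one>\<^bsub>R\<^esub>)"
    using assms by (simp add: rsmult_add_right)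
  also have "\<dots> = \<zero>\<^bsub>M\<^esub>"
    using assms by (simp add: R.l_neg rsmult_zero_right)
  finally show ?thesis
    using assms by (metis M.minus_equality R.a_inv_closed R.one_closed rsmult_closed)
qed

text \<open>Closure under negation comes from the action of \<open>\<ominus> \<one>\<close>, so
  subgroup membership reduces to these four conditions.\<close>

lemma rsubmoduleI:
  assumes "N \<subseteq> carrier M" "\<zero>\<^bsub>M\<^esub> \<in> N"
    and "\<And>x y. \<lbrakk>x \<in> N; y \<in> N\<rbrakk> \<Longrightarrow> x \<oplus>\<^bsub>M\<^esub> y \<in> N"
    and smult: "\<And>x a. \<lbrakk>x \<in> N; a \<in> carrier R\<rbrakk> \<Longrightarrow> x \<star>\<^bsub>M\<^esub> a \<in> N"
  shows "rsubmodule R M N"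
proof -
  have "\<ominus>\<^bsub>M\<^esub> x \<in> N" if "x \<in> N" for x
    using smult[OF that, of "\<ominus>\<^bsub>R\<^esub> \<one>\<^bsub>R\<^esub>"] that assms(1) rsmult_minus_one by auto
  then have "subgroup N (add_monoid M)"
    using assms by (intro subgroup.intro) (auto simp: a_inv_def)
  then show ?thesis
    using smult by (simp add: rsubmodule_def additive_subgroup_def)
qed

lemma rsubmodule_finsum:
  assumes N: "rsubmodule R M N" and "finite S" "v \<in> S \<rightarrow> N"
  shows "finsum M v S \<in> N"
  using assms(2,3)
proof (induction S rule: finite_induct)
  case empty
  then show ?case using rsubmoduleD(2)[OF N] by simp
next
  case (insert s S)
  then have "v \<in> S \<rightarrow> carrier M" "v s \<in> carrier M"
    using rsubmoduleD(1)[OF N] by auto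
  with insert show ?case
    using rsubmoduleD(3)[OF N] by (simp add: Pi_iff)
qed

text \<open>Cyclic submodules serve as test submodules for essentiality.\<close>

lemma cyclic_rsubmodule:
  assumes "x \<in> carrier M"
  shows "rsubmodule R M ((\<lambda>a. x \<star>\<^bsub>M\<^esub> a) ` carrier R)"
proof (rule rsubmoduleI)
  show "\<zero>\<^bsub>M\<^esub> \<in> (\<lambda>a. x \<star>\<^bsub>M\<^esub> a) ` carrier R"
    using rsmult_zero_right[OF assms] by (metis R.zero_closed imageI)
next
  fix y z assume "y \<in> (\<lambda>a. x \<star>\<^bsub>M\<^esub> a) ` carrier R" "z \<in> (\<lambda>a. x \<star>\<^bsub>M\<^esub> a) ` carrier R"
  then show "y \<oplus>\<^bsub>M\<^esub> z \<in> (\<lambda>a. x \<star>\<^bsub>M\<^esub> a) ` carrier R"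
    using assms by (auto simp flip: rsmult_add_right)
next
  fix y a assume "y \<in> (\<lambda>a. x \<star>\<^bsub>M\<^esub> a) ` carrier R" "a \<in> carrier R"
  then show "y \<star>\<^bsub>M\<^esub> a \<in> (\<lambda>a. x \<star>\<^bsub>M\<^esub> a) ` carrier R"
    using assms by (auto simp flip: rsmult_assoc)
qed (use assms in auto)

lemma rmodule_hom_funpow:
  assumes "f \<in> rmodule_hom R M M"
  shows "f ^^ n \<in> rmodule_hom R M M"
  using rmodule_homD[OF assms] by (induction n) (auto simp: rmodule_hom_def Pi_iff)

lemma rmodule_hom_lmult:
  assumes "f \<in> rmodule_hom R M (regular_rmodule R)" "w \<in> carrier R"
  shows "(\<lambda>p. w \<otimes>\<^bsub>R\<^esub> f p) \<in> rmodule_hom R M (regular_rmodule R)"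
  using rmodule_homD[OF assms(1)] assms(2)
  by (auto simp: rmodule_hom_def R.r_distr R.m_assoc)

end


section \<open>A Fitting decomposition\<close>

text \<open>This is the Fitting null component, the union of the kernels of the powers of
  \<open>f\<close>; the exponent may vary with the element.\<close>

definition nil_part :: "('a, 'm) rmodule \<Rightarrow> ('m \<Rightarrow> 'm) \<Rightarrow> 'm set" where
  "nil_part M f = {x \<in> carrier M. \<exists>m. (f ^^ m) x = \<zero>\<^bsub>M\<^esub>}"

context right_module
begin

lemma rsubmodule_nil_part:
  assumes f: "f \<in> rmodule_hom R M M"
  shows "rsubmodule R M (nil_part M f)"
proof -
  note pow = rmodule_hom_funpow[OF f]
  note mod = right_module_axioms
  have up: "(f ^^ (k + m)) x = \<zero>\<^bsub>M\<^esub>" if "(f ^^ m) x = \<zero>\<^bsub>M\<^esub>" for k m x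
    using that rmodule_hom_zero[OF mod mod pow] by (simp add: funpow_add)
  show ?thesis
  proof (rule rsubmoduleI)
    fix x y assume "x \<in> nil_part M f" "y \<in> nil_part M f"
    then obtain m n where x: "x \<in> carrier M" "(f ^^ m) x = \<zero>\<^bsub>M\<^esub>"
      and y: "y \<in> carrier M" "(f ^^ n) y = \<zero>\<^bsub>M\<^esub>"
      by (auto simp: nil_part_def)
    \<comment> \<open>The kernels of the powers ascend, so the sum of the two exponents kills both
      terms.\<close>
    have "(f ^^ (n + m)) (x \<oplus>\<^bsub>M\<^esub> y) = \<zero>\<^bsub>M\<^esub>"
      using up[OF x(2), of n] up[OF y(2), of m] rmodule_homD(2)[OF pow x(1) y(1)]
      by (simp add: add.commute)
    with x y show "x \<oplus>\<^bsub>M\<^esub> y \<in> nil_part M f" by (auto simp: nil_part_def)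
  next
    fix x a assume "x \<in> nil_part M f" "a \<in> carrier R"
    moreover from this obtain m where "(f ^^ m) x = \<zero>\<^bsub>M\<^esub>" by (auto simp: nil_part_def)
    ultimately have "(f ^^ m) (x \<star>\<^bsub>M\<^esub> a) = \<zero>\<^bsub>M\<^esub>"
      using rmodule_homD(3)[OF pow, of x a m] by (auto simp: nil_part_def rsmult_zero_left)
    then show "x \<star>\<^bsub>M\<^esub> a \<in> nil_part M f"
      using \<open>x \<in> nil_part M f\<close> \<open>a \<in> carrier R\<close> by (auto simp: nil_part_def)
  qed (auto simp: nil_part_def intro: exI[of _ 0])
qed

text \<open>As \<open>f\<close> and \<open>g\<close> add up to the identity they commute, so powers
  of the composite split as \<open>f ^^ k\<close> after \<open>g ^^ k\<close>. The complement is
  \<open>nil_part M g\<close>, just as powers of \<open>t\<close> and \<open>1 - t\<close> are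
  coprime polynomials.\<close>

lemma direct_summand_nil_part:
  assumes f: "f \<in> rmodule_hom R M M" and g: "g \<in> rmodule_hom R M M"
    and sum: "\<And>x. x \<in> carrier M \<Longrightarrow> f x \<oplus>\<^bsub>M\<^esub> g x = x"
    and nil: "\<And>x. x \<in> carrier M \<Longrightarrow> \<exists>k. ((\<lambda>x. f (g x)) ^^ k) x = \<zero>\<^bsub>M\<^esub>"
  shows "direct_summand R M (nil_part M f)"
proof -
  note fc = rmodule_homD(1)[OF f] and gc = rmodule_homD(1)[OF g]
  note fp = rmodule_homD(1)[OF rmodule_hom_funpow[OF f]]
    and gp = rmodule_homD(1)[OF rmodule_hom_funpow[OF g]]
  note mod = right_module_axioms
  have f0: "(f ^^ n) \<zero>\<^bsub>M\<^esub> = \<zero>\<^bsub>M\<^esub>" and g0: "(g ^^ n) \<zero>\<^bsub>M\<^esub> = \<zero>\<^bsub>M\<^esub>" for n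
    by (rule rmodule_hom_zero[OF mod mod rmodule_hom_funpow[OF f]],
        rule rmodule_hom_zero[OF mod mod rmodule_hom_funpow[OF g]])
  \<comment> \<open>Apply \<open>f\<close> to \<open>f x \<oplus> g x = x\<close>, compare with the
    same decomposition of \<open>f x\<close>, and cancel \<open>f (f x)\<close>.\<close>
  have comm: "f (g x) = g (f x)" if x: "x \<in> carrier M" for x
  proof -
    have "f (f x) \<oplus>\<^bsub>M\<^esub> f (g x) = f x"
      using rmodule_homD(2)[OF f fc[OF x] gc[OF x]] sum[OF x] by simp
    also have "\<dots> = f (f x) \<oplus>\<^bsub>M\<^esub> g (f x)" using sum[OF fc[OF x]] by simp
    finally show ?thesis using x fc gc by simp
  qed
  have comm_g: "f ((g ^^ n) x) = (g ^^ n) (f x)" if x: "x \<in> carrier M" for n x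
    using x comm gp by (induction n) auto
  have comm_f: "g ((f ^^ n) x) = (f ^^ n) (g x)" if x: "x \<in> carrier M" for n x
    using x comm[symmetric] fp by (induction n) auto
  have pow: "((\<lambda>x. f (g x)) ^^ k) x = (f ^^ k) ((g ^^ k) x)" if x: "x \<in> carrier M" for k x
  proof (induction k)
    case (Suc k)
    then show ?case using x gp comm_f by simp
  qed simp
  let ?D = "nil_part M f" and ?E = "nil_part M g"
  note D = rsubmodule_nil_part[OF f] and E = rsubmodule_nil_part[OF g]
  \<comment> \<open>Induction on \<open>m + n\<close> replaces a binomial expansion: passing to
    \<open>f x\<close> lowers \<open>m\<close>, passing to \<open>g x\<close> lowers
    \<open>n\<close>, and the two decompositions add up to one of \<open>x\<close>.\<close>
  have split: "\<exists>d\<in>?D. \<exists>e\<in>?E. x = d \<oplus>\<^bsub>M\<^esub> e"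
    if "x \<in> carrier M" "(f ^^ m) ((g ^^ n) x) = \<zero>\<^bsub>M\<^esub>" for x m n
    using that
  proof (induction "m + n" arbitrary: m n x rule: less_induct)
    case less
    show ?case
    proof (cases "m = 0 \<or> n = 0")
      case True
      \<comment> \<open>With one exponent zero, a power of the other map alone kills
        \<open>x\<close>, and the second component is taken to be zero.\<close>
      then have "x \<in> ?D \<or> x \<in> ?E" using less.prems by (auto simp: nil_part_def)
      then show ?thesis
        using rsubmoduleD(2)[OF D] rsubmoduleD(2)[OF E] less.prems(1)
        by (metis M.l_zero M.r_zero)
    next
      case False
      then obtain m' n' where mn: "m = Suc m'" "n = Suc n'" by (auto simp: gr0_conv_Suc)
      have "(f ^^ m') ((g ^^ n) (f x)) = \<zero>\<^bsub>M\<^esub>" "(f ^^ m) ((g ^^ n') (g x)) = \<zero>\<^bsub>M\<^esub>"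
        using less.prems mn(1) comm_g[OF less.prems(1), of n]
        by (auto simp: mn funpow_swap1)
      then obtain d1 e1 d2 e2 where de: "d1 \<in> ?D" "e1 \<in> ?E" "f x = d1 \<oplus>\<^bsub>M\<^esub> e1"
        "d2 \<in> ?D" "e2 \<in> ?E" "g x = d2 \<oplus>\<^bsub>M\<^esub> e2"
        using less.hyps[of m' n "f x"] less.hyps[of m n' "g x"] less.prems(1) fc gc mn
        by (metis add_less_mono1 lessI nat_add_left_cancel_less)
      then have c: "d1 \<in> carrier M" "d2 \<in> carrier M" "e1 \<in> carrier M" "e2 \<in> carrier M"
        by (auto simp: nil_part_def)
      have "x = (d1 \<oplus>\<^bsub>M\<^esub> e1) \<oplus>\<^bsub>M\<^esub> (d2 \<oplus>\<^bsub>M\<^esub> e2)"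
        using sum[OF less.prems(1)] de by simp
      also have "\<dots> = (d1 \<oplus>\<^bsub>M\<^esub> d2) \<oplus>\<^bsub>M\<^esub> (e1 \<oplus>\<^bsub>M\<^esub> e2)"
        using c by (simp add: M.a_ac)
      finally show ?thesis
        using rsubmoduleD(3)[OF D de(1,4)] rsubmoduleD(3)[OF E de(2,5)] by blast
    qed
  qed
  \<comment> \<open>The same induction shows that \<open>f x\<close> and \<open>g x\<close> vanish,
    hence so does their sum \<open>x\<close>.\<close>
  have disjoint: "x = \<zero>\<^bsub>M\<^esub>"
    if "x \<in> carrier M" "(f ^^ m) x = \<zero>\<^bsub>M\<^esub>" "(g ^^ n) x = \<zero>\<^bsub>M\<^esub>" for x m n
    using that
  proof (induction "m + n" arbitrary: m n x rule: less_induct)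
    case less
    show ?case
    proof (cases "m = 0 \<or> n = 0")
      case True
      then show ?thesis using less.prems by auto
    next
      case False
      then obtain m' n' where mn: "m = Suc m'" "n = Suc n'" by (auto simp: gr0_conv_Suc)
      have "(f ^^ m') (f x) = \<zero>\<^bsub>M\<^esub>" "(g ^^ n) (f x) = \<zero>\<^bsub>M\<^esub>"
        "(f ^^ m) (g x) = \<zero>\<^bsub>M\<^esub>" "(g ^^ n') (g x) = \<zero>\<^bsub>M\<^esub>"
        using less.prems mn comm_g[OF less.prems(1), of n] comm_f[OF less.prems(1), of m]
          f0[of 1] g0[of 1]
        by (auto simp: funpow_swap1)
      then have "f x = \<zero>\<^bsub>M\<^esub>" "g x = \<zero>\<^bsub>M\<^esub>"
        using less.hyps[of m' n "f x"] less.hyps[of m n' "g x"] less.prems(1) fc gc mn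
        by auto
      then show ?thesis using sum[OF less.prems(1)] by simp
    qed
  qed
  have "?D \<inter> ?E = {\<zero>\<^bsub>M\<^esub>}"
    using disjoint rsubmoduleD(2)[OF D] rsubmoduleD(2)[OF E] by (auto simp: nil_part_def)
  moreover have "?D <+>\<^bsub>M\<^esub> ?E = carrier M"
  proof
    show "?D <+>\<^bsub>M\<^esub> ?E \<subseteq> carrier M" by (auto simp: set_add_def' nil_part_def)
    show "carrier M \<subseteq> ?D <+>\<^bsub>M\<^esub> ?E"
    proof
      fix x assume x: "x \<in> carrier M"
      then obtain k where "(f ^^ k) ((g ^^ k) x) = \<zero>\<^bsub>M\<^esub>" using nil pow by metis
      from split[OF x this] show "x \<in> ?D <+>\<^bsub>M\<^esub> ?E" by (auto simp: set_add_def')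
    qed
  qed
  ultimately show ?thesis using D E unfolding direct_summand_def by blast
qed

end


section \<open>Large subsets and the right singular ideal\<close>

text \<open>For submodules \<open>K\<close> this is essentiality in \<open>M\<close>.\<close>

definition large :: "('a, 'r) ring_scheme \<Rightarrow> ('a, 'm) rmodule \<Rightarrow> 'm set \<Rightarrow> bool" where
  "large R M K \<longleftrightarrow>
     (\<forall>x\<in>carrier M. x \<noteq> \<zero>\<^bsub>M\<^esub> \<longrightarrow> (\<exists>r\<in>carrier R. x \<star>\<^bsub>M\<^esub> r \<noteq> \<zero>\<^bsub>M\<^esub> \<and> x \<star>\<^bsub>M\<^esub> r \<in> K))"

text \<open>If \<open>f x\<close> is zero then \<open>x\<close> itself lies in the preimage.
  Otherwise a multiplier for \<open>f x\<close> also works for \<open>x\<close>, since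
  \<open>f (x \<star> r) \<noteq> \<zero>\<close> forces
  \<open>x \<star> r \<noteq> \<zero>\<close>.\<close>

lemma (in right_module) large_vimage:
  assumes N: "right_module R N" and f: "f \<in> rmodule_hom R M N"
    and K: "large R N K" "\<zero>\<^bsub>N\<^esub> \<in> K"
  shows "large R M {x. f x \<in> K}"
  unfolding large_def
proof (intro ballI impI)
  fix x assume x: "x \<in> carrier M" "x \<noteq> \<zero>\<^bsub>M\<^esub>"
  show "\<exists>r\<in>carrier R. x \<star>\<^bsub>M\<^esub> r \<noteq> \<zero>\<^bsub>M\<^esub> \<and> x \<star>\<^bsub>M\<^esub> r \<in> {x. f x \<in> K}"
  proof (cases "f x = \<zero>\<^bsub>N\<^esub>")
    case True
    then show ?thesis using x K(2) by (intro bexI[of _ "\<one>\<^bsub>R\<^esub>"]) auto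
  next
    case False
    then obtain r where r: "r \<in> carrier R" "f x \<star>\<^bsub>N\<^esub> r \<noteq> \<zero>\<^bsub>N\<^esub>" "f x \<star>\<^bsub>N\<^esub> r \<in> K"
      using K(1) rmodule_homD(1)[OF f x(1)] unfolding large_def by blast
    then show ?thesis
      using rmodule_homD(3)[OF f x(1)] rmodule_hom_zero[OF right_module_axioms N f] by force
  qed
qed

text \<open>Multipliers are composed one after the other; closure of each \<open>K s\<close> under
  scalars preserves the memberships already reached.\<close>

lemma (in right_module) large_INT:
  assumes "finite S"
    and "\<And>s. s \<in> S \<Longrightarrow> large R M (K s)"
    and "\<And>s x r. \<lbrakk>s \<in> S; x \<in> carrier M; x \<in> K s; r \<in> carrier R\<rbrakk> \<Longrightarrow> x \<star>\<^bsub>M\<^esub> r \<in> K s"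
  shows "large R M {x. \<forall>s\<in>S. x \<in> K s}"
  using assms
proof (induction S rule: finite_induct)
  case empty
  then show ?case by (auto simp: large_def intro!: bexI[of _ "\<one>\<^bsub>R\<^esub>"])
next
  case (insert s S)
  have IH: "large R M {x. \<forall>s\<in>S. x \<in> K s}" using insert by simp
  show ?case
    unfolding large_def
  proof (intro ballI impI)
    fix x assume x: "x \<in> carrier M" "x \<noteq> \<zero>\<^bsub>M\<^esub>"
    then obtain r where r: "r \<in> carrier R" "x \<star>\<^bsub>M\<^esub> r \<noteq> \<zero>\<^bsub>M\<^esub>" "\<forall>s\<in>S. x \<star>\<^bsub>M\<^esub> r \<in> K s"
      using IH unfolding large_def by blast
    have "large R M (K s)" using insert.prems(1) by simp
    then obtain q where q: "q \<in> carrier R" "(x \<star>\<^bsub>M\<^esub> r) \<star>\<^bsub>M\<^esub> q \<noteq> \<zero>\<^bsub>M\<^esub>" "(x \<star>\<^bsub>M\<^esub> r) \<star>\<^bsub>M\<^esub> q \<in> K s"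
      using r x unfolding large_def by (meson rsmult_closed)
    have "\<forall>t\<in>S. (x \<star>\<^bsub>M\<^esub> r) \<star>\<^bsub>M\<^esub> q \<in> K t"
      using insert.prems(2) r q x by simp
    then show "\<exists>r\<in>carrier R. x \<star>\<^bsub>M\<^esub> r \<noteq> \<zero>\<^bsub>M\<^esub> \<and> x \<star>\<^bsub>M\<^esub> r \<in> {x. \<forall>s\<in>insert s S. x \<in> K s}"
      using q r x by (intro bexI[of _ "r \<otimes>\<^bsub>R\<^esub> q"]) (auto simp: rsmult_assoc)
  qed
qed

section \<open>The right singular ideal and its nilpotency\<close>

definition right_singular_ideal :: "('a, 'r) ring_scheme \<Rightarrow> 'a set" where
  "right_singular_ideal R =
     {c \<in> carrier R. large R (regular_rmodule R) {x. c \<otimes>\<^bsub>R\<^esub> x = \<zero>\<^bsub>R\<^esub>}}"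

text \<open>Only products of \<open>n\<close> factors are collected, not their sums: this set has
  the same right annihilator as its additive span, and either both vanish or neither does.\<close>

fun power_products :: "('a, 'r) ring_scheme \<Rightarrow> 'a set \<Rightarrow> nat \<Rightarrow> 'a set" where
  "power_products R Z 0 = {\<one>\<^bsub>R\<^esub>}"
| "power_products R Z (Suc n) = {w \<otimes>\<^bsub>R\<^esub> b | w b. w \<in> power_products R Z n \<and> b \<in> Z}"

context ring
begin

lemma right_singular_ideal_closed: "right_singular_ideal R \<subseteq> carrier R"
  by (auto simp: right_singular_ideal_def)

text \<open>Whatever \<open>c\<close> annihilates from the left is annihilated by
  \<open>s \<otimes> c\<close> too.\<close>

lemma right_singular_ideal_lmult:
  assumes "s \<in> carrier R" "c \<in> right_singular_ideal R"
  shows "s \<otimes> c \<in> right_singular_ideal R"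
  unfolding right_singular_ideal_def large_def
proof (intro CollectI conjI ballI impI)
  fix x assume x: "x \<in> carrier (regular_rmodule R)" "x \<noteq> \<zero>\<^bsub>regular_rmodule R\<^esub>"
  then obtain r where "r \<in> carrier R" "x \<otimes> r \<noteq> \<zero>" "c \<otimes> (x \<otimes> r) = \<zero>"
    using assms unfolding right_singular_ideal_def large_def by auto
  then show "\<exists>r\<in>carrier R. x \<star>\<^bsub>regular_rmodule R\<^esub> r \<noteq> \<zero>\<^bsub>regular_rmodule R\<^esub> \<and>
      x \<star>\<^bsub>regular_rmodule R\<^esub> r \<in> {x. s \<otimes> c \<otimes> x = \<zero>}"
    using assms x by (auto simp: right_singular_ideal_def m_assoc)
qed (use assms in \<open>auto simp: right_singular_ideal_def\<close>)

lemma power_products_closed: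
  "Z \<subseteq> carrier R \<Longrightarrow> power_products R Z n \<subseteq> carrier R"
  by (induction n) auto

text \<open>The recursion appends factors on the right, but the growth of right annihilators needs a
  factor split off on the left.\<close>

lemma power_products_Suc_left:
  assumes "Z \<subseteq> carrier R" "w \<in> power_products R Z (Suc n)"
  shows "\<exists>s\<in>carrier R. \<exists>v\<in>power_products R Z n. w = s \<otimes> v"
  using assms(2)
proof (induction n arbitrary: w)
  case 0
  then show ?case using assms(1) by auto
next
  case (Suc n)
  then obtain v b where v: "v \<in> power_products R Z (Suc n)" "b \<in> Z" "w = v \<otimes> b" by auto
  from Suc.IH[OF v(1)] obtain s t where s: "s \<in> carrier R" "t \<in> power_products R Z n" "v = s \<otimes> t"
    by blast
  have "b \<in> carrier R" "t \<in> carrier R"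
    using v(2) s(2) assms(1) power_products_closed[OF assms(1)] by blast+
  then have "w = s \<otimes> (t \<otimes> b)"
    using s(1) by (simp add: v(3) s(3) m_assoc)
  moreover have "t \<otimes> b \<in> power_products R Z (Suc n)" using s(2) v(2) by auto
  ultimately show ?case using s(1) by blast
qed

text \<open>Without a maximal annihilator, iterating a choice of strictly larger ones would give an
  ascending chain that never stabilizes.\<close>

lemma acc_right_annihilators_maximal:
  assumes acc: "acc_right_annihilators R" and T: "T \<subseteq> carrier R" "T \<noteq> {}"
  shows "\<exists>a\<in>T. \<forall>b\<in>T. \<not> right_annihilator R {a} \<subset> right_annihilator R {b}"
proof (rule ccontr)
  assume "\<not> ?thesis"
  then have "\<forall>a\<in>T. \<exists>b\<in>T. right_annihilator R {a} \<subset> right_annihilator R {b}" by blast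
  then obtain g where g: "\<And>a. a \<in> T \<Longrightarrow> g a \<in> T \<and> right_annihilator R {a} \<subset> right_annihilator R {g a}"
    by metis
  obtain a where a: "a \<in> T" using T by blast
  let ?A = "\<lambda>n. right_annihilator R {(g ^^ n) a}"
  have mem: "(g ^^ n) a \<in> T" for n using a g by (induction n) auto
  have "?A n \<subset> ?A (Suc n)" for n using g[OF mem[of n]] by simp
  moreover have "\<exists>X\<subseteq>carrier R. ?A n = right_annihilator R X" for n
    using mem[of n] T by (intro exI[of _ "{(g ^^ n) a}"]) auto
  ultimately have "\<exists>n. \<forall>m\<ge>n. ?A m = ?A n"
    by (intro acc[unfolded acc_right_annihilators_def, rule_format, of ?A]) blast
  then obtain n where "\<forall>m\<ge>n. ?A m = ?A n" ..
  then have "?A (Suc n) = ?A n" using le_SucI by blast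
  with \<open>?A n \<subset> ?A (Suc n)\<close> show False by blast
qed

text \<open>The annihilators of the power products stabilize at some \<open>n\<close>. If
  \<open>?W n\<close> were nonzero, take \<open>a\<close> not killed by it with maximal annihilator.
  For \<open>b\<close> in \<open>?Z\<close> the annihilator of \<open>b \<otimes> a\<close> is
  strictly larger, so \<open>?W n\<close> kills \<open>b \<otimes> a\<close>. Then
  \<open>?W (Suc n)\<close> kills \<open>a\<close>, and by stability so does
  \<open>?W n\<close>.\<close>

theorem right_singular_ideal_nilpotent:
  assumes acc: "acc_right_annihilators R"
  shows "\<exists>n. power_products R (right_singular_ideal R) n \<subseteq> {\<zero>}"
proof -
  let ?Z = "right_singular_ideal R"
  let ?W = "power_products R ?Z"
  note Z = right_singular_ideal_closed
  note W = power_products_closed[OF Z]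
  have "right_annihilator R (?W n) \<subseteq> right_annihilator R (?W (Suc n))" for n
  proof
    fix a assume a: "a \<in> right_annihilator R (?W n)"
    have "w \<otimes> a = \<zero>" if w: "w \<in> ?W (Suc n)" for w
    proof -
      obtain s v where "s \<in> carrier R" "v \<in> ?W n" "w = s \<otimes> v"
        using power_products_Suc_left[OF Z w] by blast
      then show ?thesis
        using a W[of n] by (auto simp: right_annihilator_def m_assoc subset_iff)
    qed
    with a show "a \<in> right_annihilator R (?W (Suc n))" by (auto simp: right_annihilator_def)
  qed
  moreover have "\<exists>X\<subseteq>carrier R. right_annihilator R (?W n) = right_annihilator R X" for n
    using W by blast
  ultimately have "\<exists>n. \<forall>m\<ge>n. right_annihilator R (?W m) = right_annihilator R (?W n)"
    by (intro acc[unfolded acc_right_annihilators_def, rule_format,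
          of "\<lambda>n. right_annihilator R (?W n)"]) blast
  then obtain n where "\<forall>m\<ge>n. right_annihilator R (?W m) = right_annihilator R (?W n)" ..
  then have stable: "right_annihilator R (?W (Suc n)) = right_annihilator R (?W n)"
    using le_SucI by blast
  have "?W n \<subseteq> {\<zero>}"
  proof (rule ccontr)
    assume nonzero: "\<not> ?thesis"
    let ?T = "{a \<in> carrier R. \<exists>w\<in>?W n. w \<otimes> a \<noteq> \<zero>}"
    obtain w where w: "w \<in> ?W n" "w \<noteq> \<zero>" using nonzero by blast
    \<comment> \<open>The unit witnesses that \<open>?T\<close> is inhabited.\<close>
    then have "w \<otimes> \<one> \<noteq> \<zero>" using W[of n] by auto
    with w have "?T \<noteq> {}" by blast
    then have "\<exists>a\<in>?T. \<forall>b\<in>?T. \<not> right_annihilator R {a} \<subset> right_annihilator R {b}"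
      by (intro acc_right_annihilators_maximal[OF acc]) blast
    then obtain a where a: "a \<in> ?T"
      and max: "\<forall>b\<in>?T. \<not> right_annihilator R {a} \<subset> right_annihilator R {b}"
      by (elim bexE)
    have ac: "a \<in> carrier R" using a by simp
    have "a \<noteq> \<zero>" using a W[of n] by auto
    have "w \<otimes> (b \<otimes> a) = \<zero>" if w: "w \<in> ?W n" and b: "b \<in> ?Z" for w b
    proof (rule ccontr)
      assume neq: "w \<otimes> (b \<otimes> a) \<noteq> \<zero>"
      have bc: "b \<in> carrier R" using b Z by blast
      \<comment> \<open>The annihilator of \<open>b\<close> is large, so it contains a nonzero
        multiple of \<open>a\<close>; this \<open>r\<close> makes the inclusion of annihilators
        strict.\<close>
      obtain r where r: "r \<in> carrier R" "a \<otimes> r \<noteq> \<zero>" "b \<otimes> (a \<otimes> r) = \<zero>"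
        using b ac \<open>a \<noteq> \<zero>\<close> unfolding right_singular_ideal_def large_def by auto
      have "right_annihilator R {a} \<subseteq> right_annihilator R {b \<otimes> a}"
        using ac bc by (auto simp: right_annihilator_def m_assoc)
      moreover have "r \<in> right_annihilator R {b \<otimes> a}" "r \<notin> right_annihilator R {a}"
        using r ac bc by (auto simp: right_annihilator_def m_assoc)
      moreover have "b \<otimes> a \<in> ?T" using neq w ac bc by auto
      ultimately show False using max by blast
    qed
    then have "a \<in> right_annihilator R (?W (Suc n))"
      using ac W[of n] Z by (fastforce simp: right_annihilator_def m_assoc subset_iff)
    with stable a show False by (auto simp: right_annihilator_def)
  qed
  then show ?thesis ..
qed

end


section \<open>Dual bases\<close>

text \<open>By the dual basis lemma such systems characterize finitely generated projective modules.
  The expansion need not be unique, so \<open>\<phi> s (u t)\<close> need not be a Kronecker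
  delta.\<close>

locale dual_basis = right_module R M
  for R :: "('a, 'r) ring_scheme" (structure) and M :: "('a, 'm) rmodule" (structure) +
  fixes S :: "'i set" and u :: "'i \<Rightarrow> 'm" and \<phi> :: "'i \<Rightarrow> 'm \<Rightarrow> 'a"
  assumes finite_basis: "finite S"
    and basis_closed: "u \<in> S \<rightarrow> carrier M"
    and coord_hom: "\<And>s. s \<in> S \<Longrightarrow> \<phi> s \<in> rmodule_hom R M (regular_rmodule R)"
    and expansion: "\<And>p. p \<in> carrier M \<Longrightarrow> p = finsum M (\<lambda>s. u s \<star>\<^bsub>M\<^esub> \<phi> s p) S"
begin

text \<open>Left multiplication of all coordinates by \<open>r\<close> is linear for the right
  action. It is additive in \<open>r\<close> but in general not multiplicative, since the matrix of
  the \<open>\<phi> i (u j)\<close> intervenes in composites.\<close>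

definition coord_mult :: "'a \<Rightarrow> 'm \<Rightarrow> 'm" where
  "coord_mult r p = finsum M (\<lambda>s. u s \<star>\<^bsub>M\<^esub> (r \<otimes>\<^bsub>R\<^esub> \<phi> s p)) S"

lemma basis_mem: "s \<in> S \<Longrightarrow> u s \<in> carrier M"
  using basis_closed by auto

lemma coord_closed: "\<lbrakk>s \<in> S; p \<in> carrier M\<rbrakk> \<Longrightarrow> \<phi> s p \<in> carrier R"
  using rmodule_homD(1)[OF coord_hom] by simp

lemma coord_mult_hom:
  assumes "r \<in> carrier R"
  shows "coord_mult r \<in> rmodule_hom R M M"
proof -
  note * = basis_mem coord_closed assms
  note hom = rmodule_homD(2,3)[OF coord_hom, simplified]
  have "coord_mult r (x \<oplus>\<^bsub>M\<^esub> y) = coord_mult r x \<oplus>\<^bsub>M\<^esub> coord_mult r y"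
    if "x \<in> carrier M" "y \<in> carrier M" for x y
    unfolding coord_mult_def using that *
    by (subst M.finsum_addf[symmetric])
      (auto intro!: M.finsum_cong' simp: hom R.r_distr rsmult_add_right simp del: M.finsum_addf)
  moreover have "coord_mult r (x \<star>\<^bsub>M\<^esub> a) = coord_mult r x \<star>\<^bsub>M\<^esub> a"
    if "x \<in> carrier M" "a \<in> carrier R" for x a
    unfolding coord_mult_def using that * finite_basis
    by (subst finsum_rsmult[symmetric])
      (auto intro!: M.finsum_cong' simp: hom rsmult_assoc R.m_assoc)
  moreover have "coord_mult r x \<in> carrier M" if "x \<in> carrier M" for x
    unfolding coord_mult_def using that * by (intro M.finsum_closed) auto
  ultimately show ?thesis by (auto simp: rmodule_hom_def)
qed

lemma coord_mult_add:
  assumes "r \<in> carrier R" "q \<in> carrier R" "p \<in> carrier M"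
  shows "coord_mult r p \<oplus>\<^bsub>M\<^esub> coord_mult q p = coord_mult (r \<oplus>\<^bsub>R\<^esub> q) p"
  unfolding coord_mult_def using assms basis_mem coord_closed
  by (subst M.finsum_addf[symmetric])
    (auto intro!: M.finsum_cong' simp: R.l_distr rsmult_add_right simp del: M.finsum_addf)

lemma coord_mult_one:
  assumes "p \<in> carrier M"
  shows "coord_mult \<one>\<^bsub>R\<^esub> p = p"
proof -
  have "coord_mult \<one>\<^bsub>R\<^esub> p = finsum M (\<lambda>s. u s \<star>\<^bsub>M\<^esub> \<phi> s p) S"
    unfolding coord_mult_def using assms basis_mem coord_closed
    by (intro M.finsum_cong') auto
  also have "\<dots> = p" using expansion[OF assms] by simp
  finally show ?thesis .
qed

lemma hom_coord_mult_eq_zero: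
  assumes N: "right_module R N" and f: "f \<in> rmodule_hom R M N"
    and "r \<in> carrier R" "p \<in> carrier M"
    and "\<And>s. s \<in> S \<Longrightarrow> f (u s \<star>\<^bsub>M\<^esub> (r \<otimes>\<^bsub>R\<^esub> \<phi> s p)) = \<zero>\<^bsub>N\<^esub>"
  shows "f (coord_mult r p) = \<zero>\<^bsub>N\<^esub>"
proof -
  interpret N: right_module R N by fact
  have "f (coord_mult r p) = finsum N (\<lambda>s. f (u s \<star>\<^bsub>M\<^esub> (r \<otimes>\<^bsub>R\<^esub> \<phi> s p))) S"
    unfolding coord_mult_def using assms basis_mem coord_closed
    by (intro rmodule_hom_finsum[OF right_module_axioms N f finite_basis]) auto
  also have "\<dots> = finsum N (\<lambda>s. \<zero>\<^bsub>N\<^esub>) S"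
    using assms by (intro N.M.finsum_cong') auto
  finally show ?thesis by simp
qed

text \<open>Coordinate \<open>l\<close> of \<open>coord_mult r p\<close> is the sum of the
  \<open>\<phi> l (u s) \<otimes> (r \<otimes> \<phi> s p)\<close>, so the product can be checked
  term by term.\<close>

lemma lmult_coord_mult_eq_zero:
  assumes "w \<in> carrier R" "l \<in> S" "r \<in> carrier R" "p \<in> carrier M"
    and "\<And>s. s \<in> S \<Longrightarrow> w \<otimes>\<^bsub>R\<^esub> (\<phi> l (u s) \<otimes>\<^bsub>R\<^esub> (r \<otimes>\<^bsub>R\<^esub> \<phi> s p)) = \<zero>\<^bsub>R\<^esub>"
  shows "w \<otimes>\<^bsub>R\<^esub> \<phi> l (coord_mult r p) = \<zero>\<^bsub>R\<^esub>"
  using hom_coord_mult_eq_zero[OF R.right_module_regular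
      rmodule_hom_lmult[OF coord_hom[OF assms(2)] assms(1)] assms(3,4)]
    assms rmodule_homD(3)[OF coord_hom] basis_mem coord_closed
  by simp

text \<open>Each application of the composite contributes to the coordinates a factor \<open>\<phi>
  l (u i) \<otimes> (e \<otimes> \<phi> i (u j) \<otimes> h)\<close> from \<open>Z\<close>, and
  products of \<open>n\<close> such factors vanish.\<close>

lemma nilpotent_coord_mult_comp:
  assumes e: "e \<in> carrier R" and h: "h \<in> carrier R"
    and Z: "Z \<subseteq> carrier R" "\<And>s c. \<lbrakk>s \<in> carrier R; c \<in> Z\<rbrakk> \<Longrightarrow> s \<otimes>\<^bsub>R\<^esub> c \<in> Z"
    and nil: "power_products R Z n \<subseteq> {\<zero>\<^bsub>R\<^esub>}"
    and ehZ: "\<And>s. s \<in> carrier R \<Longrightarrow> e \<otimes>\<^bsub>R\<^esub> s \<otimes>\<^bsub>R\<^esub> h \<in> Z"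
    and p: "p \<in> carrier M"
  shows "((\<lambda>x. coord_mult e (coord_mult h x)) ^^ n) p = \<zero>\<^bsub>M\<^esub>"
proof -
  let ?z = "\<lambda>x. coord_mult e (coord_mult h x)"
  note cc = rmodule_homD(1)[OF coord_mult_hom]
  have zc: "(?z ^^ k) p \<in> carrier M" for k
    using p e h cc by (induction k) auto
  \<comment> \<open>The invariant trades applications of \<open>?z\<close> for factors of
    \<open>w\<close>: after \<open>k\<close> of them, \<open>n - k\<close> factors on the left
    suffice.\<close>
  have *: "w \<otimes>\<^bsub>R\<^esub> \<phi> l ((?z ^^ k) p) = \<zero>\<^bsub>R\<^esub>"
    if "k \<le> n" "w \<in> power_products R Z (n - k)" "l \<in> S" for k w l
    using that
  proof (induction k arbitrary: w l)
    case 0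
    then show ?case using nil p coord_closed by auto
  next
    case (Suc k)
    let ?q = "(?z ^^ k) p"
    note q = zc[of k]
    have w: "w \<in> carrier R" using Suc.prems power_products_closed[OF Z(1)] by blast
    have "w \<otimes>\<^bsub>R\<^esub> \<phi> l (coord_mult e (coord_mult h ?q)) = \<zero>\<^bsub>R\<^esub>"
    proof (rule lmult_coord_mult_eq_zero[OF w \<open>l \<in> S\<close> e cc[OF h q]])
      fix i assume i: "i \<in> S"
      let ?v = "w \<otimes>\<^bsub>R\<^esub> (\<phi> l (u i) \<otimes>\<^bsub>R\<^esub> e)"
      have li: "\<phi> l (u i) \<in> carrier R" using Suc.prems i basis_mem coord_closed by simp
      have "?v \<otimes>\<^bsub>R\<^esub> \<phi> i (coord_mult h ?q) = \<zero>\<^bsub>R\<^esub>"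
      proof (rule lmult_coord_mult_eq_zero[OF _ i h q])
        fix j assume j: "j \<in> S"
        let ?c = "\<phi> l (u i) \<otimes>\<^bsub>R\<^esub> (e \<otimes>\<^bsub>R\<^esub> \<phi> i (u j) \<otimes>\<^bsub>R\<^esub> h)"
        have ij: "\<phi> i (u j) \<in> carrier R" using i j basis_mem coord_closed by simp
        have "?c \<in> Z" using Z(2)[OF li ehZ[OF ij]] .
        \<comment> \<open>As \<open>Suc k \<le> n\<close>, this length equals \<open>n - k\<close>,
          as the induction hypothesis requires.\<close>
        then have "w \<otimes>\<^bsub>R\<^esub> ?c \<in> power_products R Z (Suc (n - Suc k))"
          using Suc.prems(2) by auto
        then have "(w \<otimes>\<^bsub>R\<^esub> ?c) \<otimes>\<^bsub>R\<^esub> \<phi> j ?q = \<zero>\<^bsub>R\<^esub>"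
          using Suc.prems(1) j by (intro Suc.IH) (auto simp: Suc_diff_Suc)
        then show "?v \<otimes>\<^bsub>R\<^esub> (\<phi> i (u j) \<otimes>\<^bsub>R\<^esub> (h \<otimes>\<^bsub>R\<^esub> \<phi> j ?q)) = \<zero>\<^bsub>R\<^esub>"
          using w li ij e h coord_closed[OF j q] by (simp add: R.m_assoc)
      qed (use w li e in auto)
      then show "w \<otimes>\<^bsub>R\<^esub> (\<phi> l (u i) \<otimes>\<^bsub>R\<^esub> (e \<otimes>\<^bsub>R\<^esub> \<phi> i (coord_mult h ?q))) = \<zero>\<^bsub>R\<^esub>"
        using w li e coord_closed[OF i cc[OF h q]] by (simp add: R.m_assoc)
    qed
    then show ?case by simp
  qed
  \<comment> \<open>At \<open>k = n\<close> only the empty product \<open>\<one>\<close> is left, so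
    every coordinate vanishes.\<close>
  have "\<phi> l ((?z ^^ n) p) = \<zero>\<^bsub>R\<^esub>" if "l \<in> S" for l
    using *[of n "\<one>\<^bsub>R\<^esub>" l] that coord_closed[OF that zc] by simp
  then have "finsum M (\<lambda>s. u s \<star>\<^bsub>M\<^esub> \<phi> s ((?z ^^ n) p)) S = finsum M (\<lambda>s. \<zero>\<^bsub>M\<^esub>) S"
    using basis_mem by (intro M.finsum_cong') (auto simp: rsmult_zero_right)
  then show ?thesis using expansion[OF zc, of n] by simp
qed

end

text \<open>Projectivity splits the epimorphism from the free module on a finite generating set. The
  generators serve as \<open>u\<close>, the components of the section as
  \<open>\<phi>\<close>.\<close>

lemma (in right_module) dual_basis_exists:
  assumes fg: "finitely_generated_rmodule R M" and proj: "projective_rmodule R M"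
  shows "\<exists>(S :: 'm set) u \<phi>. dual_basis R M S u \<phi>"
proof -
  obtain S where S: "S \<subseteq> carrier M" "finite S" "rmodule_span R M S = carrier M"
    using fg unfolding finitely_generated_rmodule_def by blast
  let ?F = "free_rmodule R S"
  let ?e = "free_eval R M (\<lambda>x. x)"
  note mod = right_module_axioms
  have F: "right_module R ?F" by (rule R.right_module_free)
  interpret F: right_module R ?F by (rule F)
  have S': "(\<lambda>x. x) \<in> S \<rightarrow> carrier M" using S by auto
  have e: "?e \<in> rmodule_hom R ?F M" by (rule free_eval_hom[OF mod S'])
  have "rsubmodule R M (?e ` carrier ?F)"
  proof (rule rsubmoduleI)
    show "\<zero>\<^bsub>M\<^esub> \<in> ?e ` carrier ?F"
      using rmodule_hom_zero[OF F mod e] by (metis F.M.zero_closed imageI)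
  next
    fix x y assume "x \<in> ?e ` carrier ?F" "y \<in> ?e ` carrier ?F"
    then show "x \<oplus>\<^bsub>M\<^esub> y \<in> ?e ` carrier ?F"
      by (auto simp flip: rmodule_homD(2)[OF e])
  next
    fix x a assume "x \<in> ?e ` carrier ?F" "a \<in> carrier R"
    then show "x \<star>\<^bsub>M\<^esub> a \<in> ?e ` carrier ?F"
      by (auto simp flip: rmodule_homD(3)[OF e])
  qed (use rmodule_homD(1)[OF e] in auto)
  moreover have "S \<subseteq> ?e ` carrier ?F"
  proof
    fix p assume p: "p \<in> S"
    \<comment> \<open>The standard basis vector at \<open>p\<close> is mapped to
      \<open>p\<close>.\<close>
    let ?d = "\<lambda>x. if x = p then \<one>\<^bsub>R\<^esub> else \<zero>\<^bsub>R\<^esub>"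
    have d: "?d \<in> carrier ?F"
      by (rule R.free_rmodule_mem[where S = "{p}"]) (use p in auto)
    have "?e ?d = finsum M (\<lambda>x. x \<star>\<^bsub>M\<^esub> ?d x) {p}"
      by (rule free_eval_superset[OF mod S' d]) (use p in auto)
    also have "\<dots> = p" using p S by (subst M.finsum_insert) auto
    finally show "p \<in> ?e ` carrier ?F" using d by (metis image_eqI)
  qed
  ultimately have "carrier M \<subseteq> ?e ` carrier ?F"
    using S(3) unfolding rmodule_span_def by blast
  then have surj: "?e ` carrier ?F = carrier M" using rmodule_homD(1)[OF e] by auto
  have "(\<lambda>x. x) \<in> rmodule_hom R M M" by (auto simp: rmodule_hom_def)
  with mod F e surj proj obtain s where
    s: "s \<in> rmodule_hom R M ?F" "\<forall>x\<in>carrier M. ?e (s x) = x"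
    unfolding projective_rmodule_def by meson
  have "dual_basis R M S (\<lambda>x. x) (\<lambda>i p. s p i)"
  proof (intro dual_basis.intro dual_basis_axioms.intro mod S')
    fix i assume "i \<in> S"
    show "(\<lambda>p. s p i) \<in> rmodule_hom R M (regular_rmodule R)"
      using rmodule_homD[OF s(1)] by (auto simp: rmodule_hom_def free_rmodule_def image_subset_iff)
  next
    fix p assume p: "p \<in> carrier M"
    then have "s p \<in> carrier ?F" using rmodule_homD(1)[OF s(1)] by blast
    then have "?e (s p) = finsum M (\<lambda>x. x \<star>\<^bsub>M\<^esub> s p x) S"
      using S by (intro free_eval_superset[OF mod S']) (auto simp: free_rmodule_def)
    then show "p = finsum M (\<lambda>x. x \<star>\<^bsub>M\<^esub> s p x) S" using s(2) p by simp
  qed (fact S(2))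
  then show ?thesis by blast
qed


section \<open>FI-extending projective modules\<close>

text \<open>Split \<open>\<one> = h \<oplus> e\<close> along a decomposition into \<open>D\<close>
  and \<open>E\<close> with \<open>I\<close> essential in \<open>D\<close>. Then \<open>e\<close>
  kills \<open>D\<close>, which contains \<open>I\<close>, while left multiplication by
  \<open>h\<close> lands in \<open>D\<close>, where \<open>I\<close> is essential.\<close>

lemma (in ring) FI_extending_idempotent:
  assumes FI: "right_FI_extending R"
    and I: "fully_invariant R (regular_rmodule R) I"
  shows "\<exists>e\<in>carrier R. \<exists>h\<in>carrier R. e \<oplus> h = \<one> \<and> (\<forall>x\<in>I. e \<otimes> x = \<zero>) \<and>
    large R (regular_rmodule R) {x. h \<otimes> x \<in> I}"
proof -
  let ?R = "regular_rmodule R"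
  interpret X: right_module R ?R by (rule right_module_regular)
  obtain D E where ess: "essential_in R ?R I D" and D: "rsubmodule R ?R D"
    and E: "rsubmodule R ?R E" and DE: "D \<inter> E = {\<zero>}" "D <+>\<^bsub>?R\<^esub> E = carrier R"
    using FI I unfolding right_FI_extending_def FI_extending_def direct_summand_def by auto
  have "\<one> \<in> D <+>\<^bsub>?R\<^esub> E" using DE by simp
  then obtain h e where he: "h \<in> D" "e \<in> E" "\<one> = h \<oplus> e" by (auto simp: set_add_def')
  have c: "h \<in> carrier R" "e \<in> carrier R" and Dc: "D \<subseteq> carrier R"
    using he rsubmoduleD(1)[OF D] rsubmoduleD(1)[OF E] by auto
  have eD: "e \<otimes> x = \<zero>" if x: "x \<in> D" for x
  proof -
    have xc: "x \<in> carrier R" using x Dc by blast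
    have eq: "x = h \<otimes> x \<oplus> e \<otimes> x"
      using he(3) c xc by (metis l_distr l_one)
    have hx: "h \<otimes> x \<in> D" using rsubmoduleD(4)[OF D he(1), of x] xc by simp
    \<comment> \<open>Written as a difference of elements of \<open>D\<close>, the product lies in
      \<open>D\<close> as well as in \<open>E\<close>, hence is zero.\<close>
    have "e \<otimes> x = x \<oplus> (h \<otimes> x) \<otimes> \<ominus> \<one>"
      using eq c xc by (metis a_comm add.inv_closed add.inv_solve_right' m_closed one_closed r_minus r_one)
    also have "\<dots> \<in> D"
      using rsubmoduleD(3)[OF D x rsubmoduleD(4)[OF D hx, of "\<ominus> \<one>"]] by simp
    finally have "e \<otimes> x \<in> D" .
    moreover have "e \<otimes> x \<in> E" using rsubmoduleD(4)[OF E he(2), of x] xc by simp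
    ultimately show ?thesis using DE(1) by blast
  qed
  have ID: "I \<subseteq> D" and I0: "\<zero> \<in> I" and Is: "rsubmodule R ?R I"
    using ess rsubmoduleD(2)[of R ?R I] by (auto simp: essential_in_def)
  have "large R ?R {x. h \<otimes> x \<in> I}"
    unfolding large_def
  proof (intro ballI impI)
    fix x assume x: "x \<in> carrier ?R" "x \<noteq> \<zero>\<^bsub>?R\<^esub>"
    show "\<exists>r\<in>carrier R. x \<star>\<^bsub>?R\<^esub> r \<noteq> \<zero>\<^bsub>?R\<^esub> \<and> x \<star>\<^bsub>?R\<^esub> r \<in> {x. h \<otimes> x \<in> I}"
    proof (cases "h \<otimes> x = \<zero>")
      case True
      then show ?thesis using x I0 by (intro bexI[of _ \<one>]) auto
    next
      case False
      let ?Y = "(\<lambda>a. (h \<otimes> x) \<otimes> a) ` carrier R"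
      have "rsubmodule R ?R ?Y" using X.cyclic_rsubmodule[of "h \<otimes> x"] x c by simp
      moreover have "?Y \<subseteq> D"
        using rsubmoduleD(4)[OF D he(1)] x c by (auto simp: m_assoc)
      moreover have "?Y \<noteq> {\<zero>}"
        using False x c by (metis imageI m_closed one_closed r_one regular_rmodule_simps(1) singletonD)
      ultimately have "I \<inter> ?Y \<noteq> {\<zero>}" using ess by (auto simp: essential_in_def)
      \<comment> \<open>Since zero lies in both sets, an intersection other than
        \<open>{\<zero>}\<close> must contain a nonzero element.\<close>
      moreover have "\<zero> \<in> ?Y"
        using x c by (intro image_eqI[of _ _ \<zero>]) auto
      ultimately obtain r where r: "r \<in> carrier R" "h \<otimes> x \<otimes> r \<in> I" "h \<otimes> x \<otimes> r \<noteq> \<zero>"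
        using I0 by auto
      then show ?thesis using x c by (intro bexI[of _ r]) (auto simp: m_assoc)
    qed
  qed
  moreover have "e \<oplus> h = \<one>" using he(3) c by (simp add: a_comm)
  ultimately show ?thesis using c eD ID by blast
qed

text \<open>This set is the annihilator of the quotient of \<open>M\<close> by \<open>N\<close>.
  Endomorphisms of the regular module are left multiplications, and the set is closed under these
  because \<open>x \<star> f \<one>\<close> is again in \<open>M\<close>.\<close>

lemma (in right_module) fully_invariant_residual:
  assumes N: "rsubmodule R M N"
  shows "fully_invariant R (regular_rmodule R) {c \<in> carrier R. \<forall>x\<in>carrier M. x \<star>\<^bsub>M\<^esub> c \<in> N}"
    (is "fully_invariant R ?R ?I")
  unfolding fully_invariant_def
proof (intro conjI ballI)
  interpret X: right_module R ?R by (rule R.right_module_regular)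
  show "rsubmodule R ?R ?I"
    using rsubmoduleD[OF N]
    by (intro X.rsubmoduleI) (auto simp: rsmult_add_right rsmult_assoc rsmult_zero_right)
  fix f assume f: "f \<in> rmodule_hom R ?R ?R"
  show "f ` ?I \<subseteq> ?I"
  proof
    fix y assume "y \<in> f ` ?I"
    then obtain c where c: "c \<in> ?I" "y = f c" by blast
    have f1: "f \<one>\<^bsub>R\<^esub> \<in> carrier R" using rmodule_homD(1)[OF f, of "\<one>\<^bsub>R\<^esub>"] by simp
    have "y = f \<one>\<^bsub>R\<^esub> \<otimes>\<^bsub>R\<^esub> c"
      using rmodule_homD(3)[OF f, of "\<one>\<^bsub>R\<^esub>" c] c by simp
    then show "y \<in> ?I" using c f1 by (auto simp: rsmult_assoc)
  qed
qed

theorem (in dual_basis) FI_extending_if_right_FI_extending: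
  assumes acc: "acc_right_annihilators R" and FI: "right_FI_extending R"
  shows "FI_extending R M"
  unfolding FI_extending_def
proof (intro allI impI)
  fix N assume fi: "fully_invariant R M N"
  then have N: "rsubmodule R M N" by (simp add: fully_invariant_def)
  let ?R = "regular_rmodule R"
  define I where "I = {c \<in> carrier R. \<forall>x\<in>carrier M. x \<star>\<^bsub>M\<^esub> c \<in> N}"
  have I: "fully_invariant R ?R I"
    unfolding I_def by (rule fully_invariant_residual[OF N])
  then have Isub: "rsubmodule R ?R I" by (simp add: fully_invariant_def)
  have Ilmult: "s \<otimes>\<^bsub>R\<^esub> c \<in> I" if "s \<in> carrier R" "c \<in> I" for s c
    using that by (auto simp: I_def rsmult_assoc)
  \<comment> \<open>For each \<open>x\<close> the map sending \<open>p\<close> to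
    \<open>x \<star> \<phi> i p\<close> is an endomorphism of \<open>M\<close>, so full invariance
    applies to it.\<close>
  have coord_I: "\<phi> i n \<in> I" if n: "n \<in> N" and i: "i \<in> S" for n i
  proof -
    have nc: "n \<in> carrier M" using n rsubmoduleD(1)[OF N] by blast
    have "x \<star>\<^bsub>M\<^esub> \<phi> i n \<in> N" if x: "x \<in> carrier M" for x
    proof -
      have "(\<lambda>p. x \<star>\<^bsub>M\<^esub> \<phi> i p) \<in> rmodule_hom R M M"
        using rmodule_homD[OF coord_hom[OF i]] x
        by (auto simp: rmodule_hom_def rsmult_add_right rsmult_assoc)
      with fi have "(\<lambda>p. x \<star>\<^bsub>M\<^esub> \<phi> i p) ` N \<subseteq> N" by (simp add: fully_invariant_def)
      with n show ?thesis by auto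
    qed
    then show ?thesis using coord_closed[OF i nc] by (simp add: I_def)
  qed
  obtain e h where e: "e \<in> carrier R" and h: "h \<in> carrier R" and eh: "e \<oplus>\<^bsub>R\<^esub> h = \<one>\<^bsub>R\<^esub>"
    and eI: "\<And>x. x \<in> I \<Longrightarrow> e \<otimes>\<^bsub>R\<^esub> x = \<zero>\<^bsub>R\<^esub>"
    and large_h: "large R ?R {x. h \<otimes>\<^bsub>R\<^esub> x \<in> I}"
    using R.FI_extending_idempotent[OF FI I] by metis
  \<comment> \<open>Whenever \<open>h \<otimes> x\<close> lies in \<open>I\<close>, so does its left
    multiple by \<open>s\<close>, and \<open>e\<close> kills it; such \<open>x\<close> form a large
    set.\<close>
  have singular: "e \<otimes>\<^bsub>R\<^esub> s \<otimes>\<^bsub>R\<^esub> h \<in> right_singular_ideal R" if s: "s \<in> carrier R" for s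
    unfolding right_singular_ideal_def large_def
  proof (intro CollectI conjI ballI impI)
    fix x assume x: "x \<in> carrier ?R" "x \<noteq> \<zero>\<^bsub>?R\<^esub>"
    then obtain r where r: "r \<in> carrier R" "x \<otimes>\<^bsub>R\<^esub> r \<noteq> \<zero>\<^bsub>R\<^esub>" "h \<otimes>\<^bsub>R\<^esub> (x \<otimes>\<^bsub>R\<^esub> r) \<in> I"
      using large_h unfolding large_def by auto
    have "e \<otimes>\<^bsub>R\<^esub> (s \<otimes>\<^bsub>R\<^esub> (h \<otimes>\<^bsub>R\<^esub> (x \<otimes>\<^bsub>R\<^esub> r))) = \<zero>\<^bsub>R\<^esub>"
      using eI Ilmult[OF s r(3)] by blast
    then show "\<exists>r\<in>carrier R. x \<star>\<^bsub>?R\<^esub> r \<noteq> \<zero>\<^bsub>?R\<^esub> \<and>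
        x \<star>\<^bsub>?R\<^esub> r \<in> {x. e \<otimes>\<^bsub>R\<^esub> s \<otimes>\<^bsub>R\<^esub> h \<otimes>\<^bsub>R\<^esub> x = \<zero>\<^bsub>R\<^esub>}"
      using r x s e h by (intro bexI[of _ r]) (auto simp: R.m_assoc)
  qed (use s e h in auto)
  define a where "a = coord_mult e"
  define b where "b = coord_mult h"
  have a: "a \<in> rmodule_hom R M M" and b: "b \<in> rmodule_hom R M M"
    using coord_mult_hom e h by (auto simp: a_def b_def)
  have ab: "a p \<oplus>\<^bsub>M\<^esub> b p = p" if "p \<in> carrier M" for p
    unfolding a_def b_def using coord_mult_add[OF e h that] coord_mult_one[OF that] eh by simp
  obtain n where "power_products R (right_singular_ideal R) n \<subseteq> {\<zero>\<^bsub>R\<^esub>}"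
    using R.right_singular_ideal_nilpotent[OF acc] by blast
  then have nil: "((\<lambda>x. a (b x)) ^^ n) p = \<zero>\<^bsub>M\<^esub>" if "p \<in> carrier M" for p
    unfolding a_def b_def
    using R.right_singular_ideal_lmult R.right_singular_ideal_closed singular that
    by (intro nilpotent_coord_mult_comp[OF e h, where Z = "right_singular_ideal R"]) auto
  let ?D = "nil_part M a"
  have summand: "direct_summand R M ?D"
    by (rule direct_summand_nil_part[OF a b ab]) (use nil in auto)
  have sum_zero: "finsum M (\<lambda>s. u s \<star>\<^bsub>M\<^esub> g s) S = \<zero>\<^bsub>M\<^esub>"
    if "\<And>s. s \<in> S \<Longrightarrow> g s = \<zero>\<^bsub>R\<^esub>" for g
  proof -
    have "finsum M (\<lambda>s. u s \<star>\<^bsub>M\<^esub> g s) S = finsum M (\<lambda>s. \<zero>\<^bsub>M\<^esub>) S"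
      using that basis_mem by (intro M.finsum_cong') (auto simp: rsmult_zero_right)
    then show ?thesis by simp
  qed
  have "N \<subseteq> ?D"
  proof
    fix x assume x: "x \<in> N"
    \<comment> \<open>The coordinates of an element of \<open>N\<close> lie in \<open>I\<close> and
      are killed by \<open>e\<close>.\<close>
    have "a x = \<zero>\<^bsub>M\<^esub>"
      unfolding a_def coord_mult_def using eI coord_I[OF x] by (intro sum_zero) auto
    then have "(a ^^ 1) x = \<zero>\<^bsub>M\<^esub>" by simp
    then show "x \<in> ?D" using x rsubmoduleD(1)[OF N] unfolding nil_part_def by blast
  qed
  moreover have "N \<inter> Y \<noteq> {\<zero>\<^bsub>M\<^esub>}"
    if Y: "rsubmodule R M Y" "Y \<subseteq> ?D" "Y \<noteq> {\<zero>\<^bsub>M\<^esub>}" for Y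
  proof -
    obtain y where y: "y \<in> Y" "y \<noteq> \<zero>\<^bsub>M\<^esub>" using Y rsubmoduleD(2)[OF Y(1)] by blast
    have Yc: "Y \<subseteq> carrier M" by (rule rsubmoduleD(1)[OF Y(1)])
    \<comment> \<open>A first multiple \<open>y1\<close> of \<open>y\<close> is chosen to make all
      singular terms in the coordinates of \<open>a (b y1)\<close> vanish.\<close>
    let ?K = "\<lambda>(i, j). {x. e \<otimes>\<^bsub>R\<^esub> \<phi> i (u j) \<otimes>\<^bsub>R\<^esub> h \<otimes>\<^bsub>R\<^esub> \<phi> j x = \<zero>\<^bsub>R\<^esub>}"
    have "large R M {x. \<forall>s\<in>S \<times> S. x \<in> ?K s}"
    proof (rule large_INT)
      fix s assume "s \<in> S \<times> S"
      then obtain i j where s: "s = (i, j)" "i \<in> S" "j \<in> S" by blast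
      have "e \<otimes>\<^bsub>R\<^esub> \<phi> i (u j) \<otimes>\<^bsub>R\<^esub> h \<in> right_singular_ideal R"
        using s by (intro singular coord_closed basis_mem)
      then show "large R M (?K s)"
        using large_vimage[OF R.right_module_regular coord_hom[OF s(3)],
            of "{x. e \<otimes>\<^bsub>R\<^esub> \<phi> i (u j) \<otimes>\<^bsub>R\<^esub> h \<otimes>\<^bsub>R\<^esub> x = \<zero>\<^bsub>R\<^esub>}"] s
        by (auto simp: right_singular_ideal_def)
      show "x \<star>\<^bsub>M\<^esub> r \<in> ?K s" if "x \<in> carrier M" "x \<in> ?K s" "r \<in> carrier R" for x r
        using that s e h rmodule_homD(3)[OF coord_hom[OF s(3)]] coord_closed basis_mem
        by (auto simp flip: R.m_assoc)
    qed (use finite_basis in auto)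
    then obtain r where r: "r \<in> carrier R" "y \<star>\<^bsub>M\<^esub> r \<noteq> \<zero>\<^bsub>M\<^esub>" "\<forall>s\<in>S \<times> S. y \<star>\<^bsub>M\<^esub> r \<in> ?K s"
      using y Yc unfolding large_def by blast
    define y1 where "y1 = y \<star>\<^bsub>M\<^esub> r"
    have y1: "y1 \<in> Y" "y1 \<noteq> \<zero>\<^bsub>M\<^esub>" "y1 \<in> carrier M"
      using rsubmoduleD(4)[OF Y(1) y(1) r(1)] r(2) Yc by (auto simp: y1_def)
    have c0: "e \<otimes>\<^bsub>R\<^esub> \<phi> i (u j) \<otimes>\<^bsub>R\<^esub> h \<otimes>\<^bsub>R\<^esub> \<phi> j y1 = \<zero>\<^bsub>R\<^esub>" if "i \<in> S" "j \<in> S" for i j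
      using r(3) that by (auto simp: y1_def)
    have eb: "e \<otimes>\<^bsub>R\<^esub> \<phi> i (b y1) = \<zero>\<^bsub>R\<^esub>" if i: "i \<in> S" for i
      unfolding b_def
    proof (rule lmult_coord_mult_eq_zero[OF e i h y1(3)])
      fix j assume j: "j \<in> S"
      then show "e \<otimes>\<^bsub>R\<^esub> (\<phi> i (u j) \<otimes>\<^bsub>R\<^esub> (h \<otimes>\<^bsub>R\<^esub> \<phi> j y1)) = \<zero>\<^bsub>R\<^esub>"
        using c0[OF i j] i y1(3) e h coord_closed basis_mem by (simp add: R.m_assoc)
    qed
    have aby: "a (b y1) = \<zero>\<^bsub>M\<^esub>"
      unfolding a_def coord_mult_def using eb by (intro sum_zero) auto
    have ac: "a y1 \<in> carrier M" "b y1 \<in> carrier M"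
      using y1 rmodule_homD(1)[OF a] rmodule_homD(1)[OF b] by auto
    \<comment> \<open>Since \<open>a (b y1)\<close> is zero, \<open>a\<close> fixes
      \<open>a y1\<close>; but some power of \<open>a\<close> kills \<open>y1\<close>, which forces
      \<open>a y1\<close> to be zero.\<close>
    have "a y1 = a (a y1 \<oplus>\<^bsub>M\<^esub> b y1)" using ab[OF y1(3)] by simp
    also have "\<dots> = a (a y1)"
      using rmodule_homD(2)[OF a ac] rmodule_homD(1)[OF a ac(1)] aby by simp
    finally have fix1: "a (a y1) = a y1" by simp
    have fixm: "(a ^^ m) (a y1) = a y1" for m
      using fix1 by (induction m) auto
    obtain m where "(a ^^ m) y1 = \<zero>\<^bsub>M\<^esub>" using y1(1) Y(2) by (auto simp: nil_part_def)
    then have "a y1 = \<zero>\<^bsub>M\<^esub>"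
      using fixm[of m] rmodule_hom_zero[OF right_module_axioms right_module_axioms a]
      by (metis funpow_swap1)
    then have by1: "b y1 = y1" using ab[OF y1(3)] ac by simp
    \<comment> \<open>A second multiple \<open>y2\<close> moves every
      \<open>h \<otimes> \<phi> i y2\<close> into \<open>I\<close>.\<close>
    let ?K' = "\<lambda>i. {x. h \<otimes>\<^bsub>R\<^esub> \<phi> i x \<in> I}"
    have "large R M {x. \<forall>i\<in>S. x \<in> ?K' i}"
    proof (rule large_INT)
      fix i assume i: "i \<in> S"
      show "large R M (?K' i)"
        using large_vimage[OF R.right_module_regular coord_hom[OF i] large_h]
          rsubmoduleD(2)[OF Isub] h by simp
      show "x \<star>\<^bsub>M\<^esub> r \<in> ?K' i" if "x \<in> carrier M" "x \<in> ?K' i" "r \<in> carrier R" for x r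
        using that i h rmodule_homD(3)[OF coord_hom[OF i]] coord_closed rsubmoduleD(4)[OF Isub]
        by (auto simp flip: R.m_assoc)
    qed (use finite_basis in auto)
    then obtain q where q: "q \<in> carrier R" "y1 \<star>\<^bsub>M\<^esub> q \<noteq> \<zero>\<^bsub>M\<^esub>" "\<forall>i\<in>S. y1 \<star>\<^bsub>M\<^esub> q \<in> ?K' i"
      using y1 unfolding large_def by blast
    define y2 where "y2 = y1 \<star>\<^bsub>M\<^esub> q"
    have y2: "y2 \<in> Y" "y2 \<noteq> \<zero>\<^bsub>M\<^esub>" "y2 \<in> carrier M"
      using rsubmoduleD(4)[OF Y(1) y1(1) q(1)] q(2) Yc by (auto simp: y2_def)
    \<comment> \<open>By \<open>b y1 = y1\<close> and \<open>eb\<close>, \<open>e\<close> kills the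
      coordinates of \<open>y1\<close> and thus of \<open>y2\<close>, so they equal their multiples
      by \<open>h\<close>.\<close>
    have "\<phi> i y2 \<in> I" if i: "i \<in> S" for i
    proof -
      have c: "\<phi> i y1 \<in> carrier R" "\<phi> i y2 \<in> carrier R" using i y1 y2 coord_closed by auto
      have "e \<otimes>\<^bsub>R\<^esub> \<phi> i y2 = (e \<otimes>\<^bsub>R\<^esub> \<phi> i y1) \<otimes>\<^bsub>R\<^esub> q"
        using rmodule_homD(3)[OF coord_hom[OF i] y1(3) q(1)] c e q by (simp add: y2_def R.m_assoc)
      then have "e \<otimes>\<^bsub>R\<^esub> \<phi> i y2 = \<zero>\<^bsub>R\<^esub>" using eb[OF i] by1 q by simp
      moreover have "e \<otimes>\<^bsub>R\<^esub> \<phi> i y2 \<oplus>\<^bsub>R\<^esub> h \<otimes>\<^bsub>R\<^esub> \<phi> i y2 = \<phi> i y2"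
        using c e h eh by (metis R.l_distr R.l_one)
      ultimately have "h \<otimes>\<^bsub>R\<^esub> \<phi> i y2 = \<phi> i y2" using c h by simp
      then show ?thesis using q(3) i by (auto simp: y2_def)
    qed
    then have "finsum M (\<lambda>s. u s \<star>\<^bsub>M\<^esub> \<phi> s y2) S \<in> N"
      using basis_mem by (intro rsubmodule_finsum[OF N finite_basis]) (auto simp: I_def)
    then have "y2 \<in> N" using expansion[OF y2(3)] by simp
    then show ?thesis using y2 by blast
  qed
  ultimately have "essential_in R M N ?D"
    using N rsubmodule_nil_part[OF a] unfolding essential_in_def by blast
  with summand show "\<exists>D. direct_summand R M D \<and> essential_in R M N D" by blast
qed

corollary FI_extending_projective:
  assumes "right_FI_extending R" "acc_right_annihilators R"
    and "right_module R M" "finitely_generated_rmodule R M" "projective_rmodule R M"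
  shows "FI_extending R M"
  using right_module.dual_basis_exists[OF assms(3-5)]
  by (elim exE) (rule dual_basis.FI_extending_if_right_FI_extending[OF _ assms(2,1)])

section \<open>The converse: the regular module is finitely generated projective\<close>

lemma (in ring) finitely_generated_regular:
  "finitely_generated_rmodule R (regular_rmodule R)"
  unfolding finitely_generated_rmodule_def
proof (intro exI conjI)
  let ?R = "regular_rmodule R"
  interpret X: right_module R ?R by (rule right_module_regular)
  have "rsubmodule R ?R (carrier R)" by (rule X.rsubmoduleI) auto
  moreover have "carrier R \<subseteq> N" if "rsubmodule R ?R N" "\<one> \<in> N" for N
    using rsubmoduleD(4)[OF that] by auto
  ultimately show "rmodule_span R ?R {\<one>} = carrier ?R"
    unfolding rmodule_span_def by auto
qed auto

text \<open>A homomorphism from the regular module is determined by its value at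
  \<open>\<one>\<close>, so any preimage \<open>c\<close> of \<open>f \<one>\<close> defines a
  lift.\<close>

lemma (in ring) projective_regular: "projective_rmodule R (regular_rmodule R)"
  unfolding projective_rmodule_def
proof (intro allI impI, elim conjE)
  let ?R = "regular_rmodule R"
  fix A :: "('a, 'a \<Rightarrow> 'a) rmodule" and B :: "('a, 'a) rmodule" and g f
  assume A: "right_module R A" and "right_module R B" and g: "g \<in> rmodule_hom R A B"
    and surj: "g ` carrier A = carrier B" and f: "f \<in> rmodule_hom R ?R B"
  interpret A: right_module R A by fact
  have "f \<one> \<in> carrier B" using rmodule_homD(1)[OF f, of \<one>] by simp
  then obtain c where c: "c \<in> carrier A" "g c = f \<one>" using surj by (metis imageE)
  have "(\<lambda>r. c \<star>\<^bsub>A\<^esub> r) \<in> rmodule_hom R ?R A"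
    using c by (auto simp: rmodule_hom_def A.rsmult_add_right A.rsmult_assoc)
  moreover have "g (c \<star>\<^bsub>A\<^esub> r) = f r" if "r \<in> carrier R" for r
    using rmodule_homD(3)[OF g c(1) that] rmodule_homD(3)[OF f, of \<one> r] c that by simp
  ultimately show "\<exists>h\<in>rmodule_hom R ?R A. \<forall>x\<in>carrier ?R. g (h x) = f x" by auto
qed

theorem theorem2p5:
  fixes R :: "('a, 'r) ring_scheme"
  assumes "ring R"
    and "acc_right_annihilators R"
  shows "right_FI_extending R \<longleftrightarrow>
    (\<forall>M :: ('a, 'a) rmodule. right_module R M \<and> finitely_generated_rmodule R M \<and>
        projective_rmodule R M \<longrightarrow> FI_extending R M) \<and>
    (\<forall>M :: ('a, 'm) rmodule. right_module R M \<and> finitely_generated_rmodule R M \<and>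
        projective_rmodule R M \<longrightarrow> FI_extending R M)"
proof -
  interpret ring R by fact
  \<comment> \<open>The converse specializes the clause for modules on the type of ring elements to
    the regular module.\<close>
  have "right_FI_extending R"
    if "\<forall>M :: ('a, 'a) rmodule. right_module R M \<and> finitely_generated_rmodule R M \<and>
        projective_rmodule R M \<longrightarrow> FI_extending R M"
    using that right_module_regular finitely_generated_regular projective_regular
    unfolding right_FI_extending_def by blast
  then show ?thesis
    by (intro iffI conjI allI impI; elim conjE) (simp_all add: FI_extending_projective assms(2))
qed

end
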